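(* For all $n \geq 0$, $$p_{\xi}(4n+2) \equiv \begin{cases} 2(-1)^k \pmod{4}, & \text{if } n=6k(3k-1) \text{ for some integer } k,\\ 0 \pmod{4}, & \text{otherwise}.\end{cases}$$
   Context: $(a;q)_n=(1-a)(1-aq)\cdots(1-aq^{n-1})$, $(a;q)_0=1$. The coefficients $p_\xi(n)$ are defined by $\sum_{n\ge0}p_\xi(n)q^n=\xi(q)=1+2\sum_{n\ge1}\frac{q^{6n^2-6n+1}}{(q;q^6)_n(q^5;q^6)_n}$. *)

theory Defs
  imports "HOL-Computational_Algebra.Formal_Power_Series" "HOL-Number_Theory.Cong"
begin

definition qpoch :: "'a::comm_ring_1 \<Rightarrow> 'a \<Rightarrow> nat \<Rightarrow> 'a" where
  "qpoch a q n = (\<Prod>k<n. 1 - a * q ^ k)"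

text \<open>The library's \<open>inverse\<close> of a power series needs an inverse on the coefficients, which
  \<^typ>\<open>int\<close> lacks. For constant term 1 the reciprocal is \<open>fps_right_inverse f 1\<close>,
  whose second argument is the constant term of the result; the lemma \<open>xi_denom_recip\<close> below
  shows that it is the reciprocal here.\<close>

definition xi_denom :: "nat \<Rightarrow> int fps" where
  "xi_denom n = qpoch fps_X (fps_X ^ 6) n * qpoch (fps_X ^ 5) (fps_X ^ 6) n"

definition xi_term :: "nat \<Rightarrow> int fps" where
  "xi_term n = fps_X ^ (6 * n\<^sup>2 - 6 * n + 1) * fps_right_inverse (xi_denom n) 1"

text \<open>The infinite sum is the limit in the metric (\<open>X\<close>-adic) topology of formal power series;
  the index is shifted because the sum starts at \<open>n = 1\<close>. Convergence is
  \<open>summable_xi_term\<close> below.\<close>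

definition xi :: "int fps" where
  "xi = 1 + 2 * (\<Sum>n. xi_term (Suc n))"

definition p_xi :: "nat \<Rightarrow> int" where
  "p_xi n = fps_nth xi n"

lemma qpoch_nth_0:
  fixes a q :: "int fps"
  assumes "fps_nth a 0 = 0"
  shows "fps_nth (qpoch a q n) 0 = 1"
  using assms by (induction n) (simp_all add: qpoch_def)

lemma xi_denom_recip: "xi_denom n * fps_right_inverse (xi_denom n) 1 = 1"
  by (rule fps_right_inverse) (simp add: xi_denom_def qpoch_nth_0)

lemma xi_term_nth_eq_0:
  assumes "m \<le> n"
  shows "fps_nth (xi_term (Suc n)) m = 0"
proof -
  have "6 * (Suc n)\<^sup>2 - 6 * Suc n + 1 = 6 * n * n + 6 * n + 1"
    by (simp add: power2_eq_square algebra_simps)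
  then have "m < 6 * (Suc n)\<^sup>2 - 6 * Suc n + 1"
    using assms by simp
  then show ?thesis
    unfolding xi_term_def by (simp only: fps_X_power_mult_nth if_True)
qed

lemma summable_xi_term: "summable (\<lambda>n. xi_term (Suc n))"
proof -
  define S where "S = Abs_fps (\<lambda>m. \<Sum>i<m. fps_nth (xi_term (Suc i)) m)"
  have "(\<lambda>n. \<Sum>i<n. xi_term (Suc i)) \<longlonglongrightarrow> S"
  proof (rule tendsto_fpsI)
    fix m
    have "fps_nth (\<Sum>i<n. xi_term (Suc i)) m = fps_nth S m" if "n \<ge> m" for n
    proof -
      have "(\<Sum>i<n. fps_nth (xi_term (Suc i)) m) = (\<Sum>i<m. fps_nth (xi_term (Suc i)) m)"
        by (rule sum.mono_neutral_right) (use that in \<open>auto intro!: xi_term_nth_eq_0\<close>)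
      then show ?thesis by (simp add: S_def fps_sum_nth)
    qed
    then show "\<forall>\<^sub>F n in sequentially. fps_nth (\<Sum>i<n. xi_term (Suc i)) m = fps_nth S m"
      unfolding eventually_sequentially by blast
  qed
  then show ?thesis unfolding summable_def sums_def by blast
qed

end

theory Submission
  imports Defs "HOL-Library.Z2" "HOL-Computational_Algebra.Formal_Laurent_Series"
begin

text \<open>Only the parity of the coefficients of \<open>G = (\<xi> - 1) / 2\<close> matters, so we compute in power series
  over the field of two elements. Expanding each summand into partial fractions and summing with
  Durfee rectangles gives the Appell-Lerch form
  \<open>(q\<^sup>6;q\<^sup>6)\<^sub>\<infinity> G = \<Sum>\<^sub>n q\<^bsup>9n(n+1)+1\<^esup> / (1 - q\<^bsup>6n+1\<^esup>)\<close> over all integers \<open>n\<close>. Write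
  \<open>E\<^sub>d = (q\<^sup>d;q\<^sup>d)\<^sub>\<infinity>\<close>. Modulo 2, the triple product gives
  \<open>E\<^sub>d\<^sup>3 = \<Sum>\<^sub>i q\<^bsup>d(2i\<^sup>2-i)\<^esup>\<close>, and \<open>E\<^sub>6\<^sup>4 = E\<^sub>2\<^sub>4\<close> involves only exponents divisible by 4. Hence
  the part of \<open>E\<^sub>2\<^sub>4 G\<close> with exponents 2 modulo 4 counts integer triples modulo 2, and involutions
  preserving the exponent cancel all of them except those on a line, whose generating function
  is \<open>q\<^sup>2 E\<^sub>2\<^sub>4\<^sup>3 = E\<^sub>2\<^sub>4 \<cdot> q\<^sup>2 E\<^sub>4\<^sub>8\<close>. Cancelling \<open>E\<^sub>2\<^sub>4\<close> and applying the pentagonal number theorem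
  to \<open>E\<^sub>4\<^sub>8\<close> finishes the proof.\<close>

section \<open>Partial fractions and the Bailey transform\<close>

text \<open>Parity decides the claim because 2(-1)^k is 2 modulo 4 for every k: after doubling, the
  sign is invisible modulo 4. The factor 1/E_6 of the Appell-Lerch form is never expanded.
  Multiplying by E_6^4 = E_24 turns it into E_6^3, a theta series in one integer variable, and since
  E_24 has constant term 1 and only exponents divisible by 4, it can be cancelled inside the residue
  class 2 modulo 4 alone. The obstacle is that the resulting ternary quadratic form is indefinite:
  finiteness of the count comes from a sign condition on the variables, and the reflections
  preserving the form do not preserve that condition. The count is therefore rewritten, by symmetric
  differences, through regions whose defining conditions are untouched by one of two reflections and
  on which the form still takes each value finitely often. The series identities are proved
  truncated at \<open>N\<close>, as finite identities in a field, so that no infinite double sum has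
  to be rearranged; only then does \<open>N\<close> tend to infinity.\<close>

lemma qpoch_Suc: "qpoch a q (Suc n) = qpoch a q n * (1 - a * q ^ n)"
  by (simp add: qpoch_def)

lemma qpoch_0 [simp]: "qpoch a q 0 = 1"
  by (simp add: qpoch_def)

lemma qpoch_Suc_shift: "qpoch a q (Suc n) = (1 - a) * qpoch (a * q) q n"
  unfolding qpoch_def by (subst prod.lessThan_Suc_shift) (simp add: mult.assoc power_Suc)

lemma qpoch_add: "qpoch a q (m + n) = qpoch a q m * qpoch (a * q ^ m) q n"
  by (induction n) (simp_all add: qpoch_Suc power_add mult.assoc)

lemma qpoch_nonzero:
  fixes a q :: "'a::idom"
  assumes "\<And>i. a * q ^ i \<noteq> 1"
  shows "qpoch a q n \<noteq> 0"
  using assms unfolding qpoch_def by (auto simp: prod_zero_iff)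

lemma triangle_Suc: "(k + 1) * k div 2 + (k + 1) = (k + 2) * (k + 1) div (2::nat)"
proof -
  have "(k + 2) * (k + 1) = (k + 1) * k + 2 * (k + 1)" by (simp add: algebra_simps)
  then show ?thesis by simp
qed

text \<open>The numerator over (1 - x q^k)(1 - y q^k) in the expansion of 1/((x;q)_{n+1}
  (y;q)_{n+1}). The variables x and y enter only through \<open>b\<close>, which stands for x
  y.\<close>

definition pf_coeff :: "'a::field \<Rightarrow> 'a \<Rightarrow> nat \<Rightarrow> nat \<Rightarrow> 'a" where
  "pf_coeff b q n k = (-1) ^ k * q ^ ((k + 1) * k div 2) * (1 - b * q ^ (2 * k)) /
     (qpoch q q k * qpoch q q (n - k) * qpoch (b * q ^ k) q (Suc n))"

text \<open>The induction step of \<open>partial_fractions\<close>, coefficient by coefficient: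
  replacing (x, y) by (x q, y q) changes b to b q^2 and shifts the index by one. With u = q^k and v
  = q^(n-k), extracting a common factor leaves (1 - q u v)(1 - b q u v) = (1 - v)(1 - b q^2 u^2 v) +
  v (1 - q u)(1 - b q u). The guard \<open>k < n\<close> excludes the spurious term that truncated
  subtraction would produce at \<open>k = n\<close>.\<close>

lemma pf_coeff_rec_Suc:
  fixes q b :: "'a::field"
  assumes k: "k \<le> n"
    and q: "\<And>i. q * q ^ i \<noteq> 1" and b: "\<And>i. b * q ^ i \<noteq> 1"
  shows "(1 - q ^ Suc n) * (1 - b * q ^ Suc n) * pf_coeff b q (Suc n) (Suc k) =
      (if k < n then pf_coeff b q n (Suc k) else 0) - q ^ Suc n * pf_coeff (b * q\<^sup>2) q n k"
proof -
  define m where "m = n - k"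
  have n: "n = k + m" using k by (simp add: m_def)
  define s where "s = (-1) ^ k * q ^ ((k + 1) * k div 2)"
  define B where "B = qpoch (b * q ^ Suc k * q) q n"
  define Q where "Q = qpoch q q k"
  define P where "P = qpoch q q m"
  define u where "u = q ^ k"
  define v where "v = q ^ m"
  have nz: "B \<noteq> 0" "Q \<noteq> 0" "P \<noteq> 0"
    unfolding B_def Q_def P_def using q b[of "Suc (Suc k) + _"]
    by (auto intro!: qpoch_nonzero simp: power_add mult_ac)
  have nz1: "1 - q * v \<noteq> 0" "1 - q * u \<noteq> 0"
    using q unfolding u_def v_def by auto
  have nz2: "1 - b * q * u \<noteq> 0" "1 - b * q\<^sup>2 * u * (u * v) \<noteq> 0"
    using b[of "Suc k"] b[of "Suc (Suc (k + (k + m)))"] unfolding u_def v_def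
    by (auto simp: power_add mult_ac power2_eq_square)
  have sSuc: "(-1) ^ Suc k * q ^ ((Suc k + 1) * Suc k div 2) = - s * (q * u)"
  proof -
    have "(Suc k + 1) * Suc k div 2 = (k + 1) * k div 2 + (k + 1)"
      using triangle_Suc[of k] by simp
    then show ?thesis by (simp add: s_def u_def power_add del: mult_Suc)
  qed
  have bS: "b * q ^ Suc k * q ^ (1 + n) = b * q\<^sup>2 * u * (u * v)"
    by (simp add: u_def v_def n power_add power2_eq_square mult_ac)
  have e1: "qpoch (b * q ^ Suc k) q (Suc (Suc n)) = (1 - b * q * u) * B * (1 - b * q\<^sup>2 * u * (u * v))"
  proof -
    have "qpoch (b * q ^ Suc k) q (Suc (Suc n)) = qpoch (b * q ^ Suc k) q (Suc n) * (1 - b * q ^ Suc k * q ^ Suc n)"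
      by (rule qpoch_Suc)
    also have "qpoch (b * q ^ Suc k) q (Suc n) = (1 - b * q ^ Suc k) * B"
      unfolding B_def by (rule qpoch_Suc_shift)
    finally show ?thesis using bS by (simp add: u_def mult_ac)
  qed
  have e2: "qpoch (b * q ^ Suc k) q (Suc n) = (1 - b * q * u) * B"
    unfolding B_def by (subst qpoch_Suc_shift) (simp add: u_def mult_ac)
  have e3: "qpoch (b * q\<^sup>2 * q ^ k) q (Suc n) = B * (1 - b * q\<^sup>2 * u * (u * v))"
  proof -
    have "b * q\<^sup>2 * q ^ k = b * q ^ Suc k * q" by (simp add: power2_eq_square mult_ac)
    moreover have "b * q ^ Suc k * q * q ^ n = b * q\<^sup>2 * u * (u * v)"
      by (simp add: u_def v_def n power_add power2_eq_square mult_ac)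
    ultimately show ?thesis by (simp only: qpoch_Suc B_def)
  qed
  have QS: "qpoch q q (Suc k) = Q * (1 - q * u)" by (simp add: qpoch_Suc Q_def u_def)
  define c where "c = 1 - b * q\<^sup>2 * u\<^sup>2"
  have c1: "1 - b * q ^ (2 * Suc k) = c"
    by (simp add: c_def u_def power_mult power2_eq_square power_add mult_ac flip: power_mult_distrib)
  have c2: "1 - b * q\<^sup>2 * q ^ (2 * k) = c"
    by (simp add: c_def u_def power_mult power2_eq_square power_add mult_ac flip: power_mult_distrib)
  have qSn: "q ^ Suc n = q * (u * v)" by (simp add: n u_def v_def power_add)
  have l1: "pf_coeff b q (Suc n) (Suc k) = (- s * (q * u)) * c /
     (Q * (1 - q * u) * P * ((1 - b * q * u) * B * (1 - b * q\<^sup>2 * u * (u * v))))"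
    unfolding pf_coeff_def sSuc c1 e1 QS by (simp add: n P_def)
  \<comment> \<open>At \<open>m = 0\<close> the factor 1 - v is zero, which reproduces the guard
    \<open>k < n\<close>.\<close>
  have l2: "(if k < n then pf_coeff b q n (Suc k) else 0) =
       (- s * (q * u)) * c * (1 - v) / (Q * (1 - q * u) * P * ((1 - b * q * u) * B))"
  proof (cases m)
    case 0
    then show ?thesis by (simp add: n v_def)
  next
    case (Suc m')
    have P: "P = qpoch q q m' * (1 - v)"
      by (simp add: P_def v_def Suc qpoch_Suc)
    have "1 - v \<noteq> 0" using q[of m'] by (simp add: v_def Suc)
    then show ?thesis
      unfolding pf_coeff_def sSuc c1 e2 QS using Suc P nz by (simp add: n mult_ac)
  qed
  have l3: "pf_coeff (b * q\<^sup>2) q n k = s * c / (Q * P * (B * (1 - b * q\<^sup>2 * u * (u * v))))"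
    unfolding pf_coeff_def c2 e3 by (simp add: s_def Q_def P_def n)
  define d where "d = s * c * (q * u) / (Q * P * B * ((1 - q * u) * (1 - b * q * u) * (1 - b * q\<^sup>2 * u * (u * v))))"
  have r1: "pf_coeff b q (Suc n) (Suc k) = - d"
    unfolding l1 d_def by (simp add: mult_ac)
  have r2: "(if k < n then pf_coeff b q n (Suc k) else 0) = - d * (1 - v) * (1 - b * q\<^sup>2 * u * (u * v))"
    unfolding l2 d_def using nz2 by (simp add: mult_ac)
  have r3: "q * u * pf_coeff (b * q\<^sup>2) q n k = d * (1 - q * u) * (1 - b * q * u)"
    unfolding l3 d_def using nz2 nz1 by (simp add: mult_ac)
  have "q * (u * v) * pf_coeff (b * q\<^sup>2) q n k = v * (q * u * pf_coeff (b * q\<^sup>2) q n k)"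
    by (simp add: mult_ac)
  then show ?thesis
    unfolding qSn r1 r2 r3 by (simp add: algebra_simps power2_eq_square)
qed

lemma pf_coeff_rec_0:
  fixes q b :: "'a::field"
  assumes q: "\<And>i. q * q ^ i \<noteq> 1" and b: "\<And>i. b * q ^ i \<noteq> 1"
  shows "(1 - q ^ Suc n) * (1 - b * q ^ Suc n) * pf_coeff b q (Suc n) 0 = pf_coeff b q n 0"
proof -
  have "qpoch b q (Suc (Suc n)) = qpoch b q (Suc n) * (1 - b * q ^ Suc n)"
    "qpoch q q (Suc n) = qpoch q q n * (1 - q ^ Suc n)"
    by (simp_all only: qpoch_Suc power_Suc)
  then show ?thesis
    using q[of n] b[of "Suc n"] by (simp add: pf_coeff_def)
qed

text \<open>Writing w_k for (1 - x q^k)(1 - y q^k), the terms linear in x + y cancel in w_{n+1} -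
  q^{n+1} w_0, which equals (1 - q^{n+1})(1 - x y q^{n+1}). Hence the reciprocal of the product of
  length n+2 is a combination of the two reciprocals of length n+1 starting at (x, y) and at (x q, y
  q); this is why x and y vary in the induction.\<close>

lemma partial_fractions:
  fixes q x y :: "'a::field"
  assumes q: "\<And>i. q * q ^ i \<noteq> 1" and b: "\<And>i. x * y * q ^ i \<noteq> 1"
    and x: "\<And>i. x * q ^ i \<noteq> 1" and y: "\<And>i. y * q ^ i \<noteq> 1"
  shows "1 / (qpoch x q (Suc n) * qpoch y q (Suc n)) =
    (\<Sum>k\<le>n. pf_coeff (x * y) q n k / ((1 - x * q ^ k) * (1 - y * q ^ k)))"
  using b x y
proof (induction n arbitrary: x y)
  case 0
  then show ?case using "0.prems"(1)[of 0] by (simp add: pf_coeff_def qpoch_Suc)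
next
  case (Suc n)
  note b = Suc.prems(1) and x = Suc.prems(2) and y = Suc.prems(3)
  define w where "w k = (1 - x * q ^ k) * (1 - y * q ^ k)" for k
  define D where "D = (1 - q ^ Suc n) * (1 - x * y * q ^ Suc n)"
  have D: "D \<noteq> 0" using q[of n] b[of "Suc n"] by (simp add: D_def)
  have wnz: "w k \<noteq> 0" for k using x y by (simp add: w_def)
  have IH0: "1 / (qpoch x q (Suc n) * qpoch y q (Suc n)) = (\<Sum>k\<le>n. pf_coeff (x * y) q n k / w k)"
    unfolding w_def by (rule Suc.IH[OF b x y])
  have IH1: "1 / (qpoch (x * q) q (Suc n) * qpoch (y * q) q (Suc n)) =
      (\<Sum>k\<le>n. pf_coeff (x * y * q\<^sup>2) q n k / w (Suc k))"
    using Suc.IH[of "x * q" "y * q"] b[of "Suc (Suc _)"] x[of "Suc _"] y[of "Suc _"]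
    by (simp add: w_def power2_eq_square mult_ac)
  define Z where "Z = qpoch (x * q) q n * qpoch (y * q) q n"
  have Z: "Z \<noteq> 0" unfolding Z_def using x[of "Suc _"] y[of "Suc _"]
    by (auto intro!: qpoch_nonzero simp: mult_ac)
  have z1: "qpoch x q (Suc n) * qpoch y q (Suc n) = w 0 * Z"
    by (simp add: qpoch_Suc_shift w_def Z_def mult_ac)
  have z2: "qpoch (x * q) q (Suc n) * qpoch (y * q) q (Suc n) = w (Suc n) * Z"
    by (simp add: qpoch_Suc w_def Z_def mult_ac)
  have z3: "qpoch x q (Suc (Suc n)) * qpoch y q (Suc (Suc n)) = w 0 * w (Suc n) * Z"
    by (simp add: qpoch_Suc[of _ _ "Suc n"] qpoch_Suc_shift[of _ _ n] w_def Z_def mult_ac)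
  have ww: "w (Suc n) - q ^ Suc n * w 0 = D"
    by (simp add: w_def D_def algebra_simps)
  have "D * (1 / (qpoch x q (Suc (Suc n)) * qpoch y q (Suc (Suc n)))) =
      1 / (w 0 * Z) - q ^ Suc n * (1 / (w (Suc n) * Z))"
    unfolding z3 ww[symmetric] using Z wnz by (simp add: field_simps)
  also have "\<dots> = (\<Sum>k\<le>n. pf_coeff (x * y) q n k / w k) -
       q ^ Suc n * (\<Sum>k\<le>n. pf_coeff (x * y * q\<^sup>2) q n k / w (Suc k))"
    using IH0 IH1 z1 z2 by simp
  also have "\<dots> = D * (\<Sum>k\<le>Suc n. pf_coeff (x * y) q (Suc n) k / w k)"
  proof -
    have "D * (\<Sum>k\<le>Suc n. pf_coeff (x * y) q (Suc n) k / w k) =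
        D * pf_coeff (x * y) q (Suc n) 0 / w 0 +
        (\<Sum>k\<le>n. D * pf_coeff (x * y) q (Suc n) (Suc k) / w (Suc k))"
      by (subst sum.atMost_Suc_shift) (simp add: distrib_left sum_distrib_left)
    also have "(\<Sum>k\<le>n. D * pf_coeff (x * y) q (Suc n) (Suc k) / w (Suc k)) =
       (\<Sum>k\<le>n. (if k < n then pf_coeff (x * y) q n (Suc k) else 0) / w (Suc k) -
          q ^ Suc n * (pf_coeff (x * y * q\<^sup>2) q n k / w (Suc k)))"
    proof (rule sum.cong)
      fix k assume "k \<in> {..n}"
      then have "D * pf_coeff (x * y) q (Suc n) (Suc k) =
          (if k < n then pf_coeff (x * y) q n (Suc k) else 0) - q ^ Suc n * pf_coeff (x * y * q\<^sup>2) q n k"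
        unfolding D_def by (intro pf_coeff_rec_Suc[OF _ q b]) simp
      then show "D * pf_coeff (x * y) q (Suc n) (Suc k) / w (Suc k) =
          (if k < n then pf_coeff (x * y) q n (Suc k) else 0) / w (Suc k) -
          q ^ Suc n * (pf_coeff (x * y * q\<^sup>2) q n k / w (Suc k))"
        by (simp only: diff_divide_distrib times_divide_eq_right)
    qed simp
    also have "\<dots> = (\<Sum>k\<le>n. (if k < n then pf_coeff (x * y) q n (Suc k) else 0) / w (Suc k)) -
          q ^ Suc n * (\<Sum>k\<le>n. (pf_coeff (x * y * q\<^sup>2) q n k / w (Suc k)))"
      by (simp add: sum_subtractf sum_distrib_left)
    also have "(\<Sum>k\<le>n. (if k < n then pf_coeff (x * y) q n (Suc k) else 0) / w (Suc k)) =
        (\<Sum>k<n. pf_coeff (x * y) q n (Suc k) / w (Suc k))"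
      by (rule sum.mono_neutral_cong_right) auto
    also have "D * pf_coeff (x * y) q (Suc n) 0 = pf_coeff (x * y) q n 0"
      unfolding D_def by (rule pf_coeff_rec_0[OF q b])
    also have "(\<Sum>k\<le>n. pf_coeff (x * y) q n k / w k) = pf_coeff (x * y) q n 0 / w 0 +
        (\<Sum>k<n. pf_coeff (x * y) q n (Suc k) / w (Suc k))"
      by (simp only: lessThan_Suc_atMost[symmetric] sum.lessThan_Suc_shift)
    ultimately show ?thesis by (simp add: algebra_simps)
  qed
  finally show ?case using D mult_cancel_left[of D] unfolding w_def by blast
qed

text \<open>Induction through 1 - q^{N+1} = (1 - q^{N+1-j}) q^j + (1 - q^j): each part cancels the
  last factor of one of the two finite products indexed by N+1-j and j. After shifting the second
  sum by one, the two sums combine termwise into the same sum for N and d+1, so d must stay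
  arbitrary.\<close>

lemma durfee_rectangle:
  fixes q :: "'a::field"
  assumes q: "\<And>i. q * q ^ i \<noteq> 1"
  shows "(\<Sum>j\<le>N. q ^ (j * (j + d)) / (qpoch q q j * qpoch q q (N - j) * qpoch q q (j + d))) =
     1 / (qpoch q q N * qpoch q q (N + d))"
proof (induction N arbitrary: d)
  case 0
  then show ?case by simp
next
  case (Suc N)
  define P where "P = qpoch q q"
  have P0: "P 0 = 1" by (simp add: P_def)
  have PS: "P (Suc n) = P n * (1 - q ^ Suc n)" for n by (simp add: P_def qpoch_Suc)
  have nz: "P n \<noteq> 0" for n unfolding P_def by (rule qpoch_nonzero) (rule q)
  have nz': "1 - q ^ Suc n \<noteq> 0" for n using q[of n] by simp
  define f where "f j = q ^ (j * (j + d)) / (P j * P (Suc N - j) * P (j + d))" for j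
  define g where "g j = q ^ (j * (j + d + 1)) / (P j * P (N - j) * P (j + d))" for j
  define h where "h j = q ^ (Suc j * (Suc j + d)) / (P j * P (N - j) * P (Suc j + d))" for j
  have fs: "(1 - q ^ Suc N) * f j = (if j \<le> N then g j else 0) + (if j = 0 then 0 else h (j - 1))"
    if "j \<le> Suc N" for j
  proof -
    have a: "(1 - q ^ (Suc N - j)) * q ^ j * f j = (if j \<le> N then g j else 0)"
    proof (cases "j \<le> N")
      case True
      then have s: "Suc N - j = Suc (N - j)" by simp
      have "q ^ (j * (j + d + 1)) = q ^ (j * (j + d)) * q ^ j"
        by (simp add: power_add)
      then show ?thesis using True nz nz'[of "N - j"] by (simp add: f_def g_def s PS field_simps)
    next
      case False
      with that have "j = Suc N" by simp
      then show ?thesis by simp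
    qed
    have b: "(1 - q ^ j) * f j = (if j = 0 then 0 else h (j - 1))"
    proof (cases j)
      case (Suc i)
      with that have "Suc N - Suc i = N - i" by simp
      then show ?thesis using Suc nz nz'[of i] by (simp add: f_def h_def PS[of i] field_simps)
    qed simp
    have "1 - q ^ Suc N = (1 - q ^ (Suc N - j)) * q ^ j + (1 - q ^ j)"
    proof -
      have "q ^ Suc N = q ^ (Suc N - j) * q ^ j" using that by (simp flip: power_add)
      then show ?thesis by (simp add: algebra_simps)
    qed
    then have "(1 - q ^ Suc N) * f j = (1 - q ^ (Suc N - j)) * q ^ j * f j + (1 - q ^ j) * f j"
      by (simp only: distrib_right)
    then show ?thesis by (simp only: a b)
  qed
  have gh: "g j + h j = q ^ (j * (j + Suc d)) / (P j * P (N - j) * P (j + Suc d))" for j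
  proof -
    define t where "t = q ^ Suc (j + d)"
    define X where "X = q ^ (j * (j + d + 1))"
    define A where "A = P j * P (N - j)"
    define B where "B = P (j + d)"
    have "Suc j * (Suc j + d) = j * (j + d + 1) + Suc (j + d)" by (simp add: algebra_simps)
    then have t1: "q ^ (Suc j * (Suc j + d)) = X * t"
      unfolding X_def t_def by (simp only: power_add)
    have t2: "P (Suc (j + d)) = B * (1 - t)" using PS[of "j + d"] by (simp add: B_def t_def)
    have nzB: "A \<noteq> 0" "B \<noteq> 0" "1 - t \<noteq> 0"
      using nz nz'[of "j + d"] by (auto simp: A_def B_def t_def)
    have "g j = X / (A * B)" "h j = X * t / (A * (B * (1 - t)))"
      using t1 t2 by (simp_all only: g_def h_def A_def B_def X_def add_Suc)
    moreover have "X / (A * B) + X * t / (A * (B * (1 - t))) = X / (A * (B * (1 - t)))"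
      using nzB by (simp add: divide_simps) (simp add: algebra_simps)
    ultimately show ?thesis using t2 by (simp add: A_def X_def)
  qed
  have "(1 - q ^ Suc N) * (\<Sum>j\<le>Suc N. f j) =
      (\<Sum>j\<le>Suc N. (if j \<le> N then g j else 0) + (if j = 0 then 0 else h (j - 1)))"
    unfolding sum_distrib_left by (rule sum.cong) (use fs in auto)
  also have "\<dots> = (\<Sum>j\<le>N. g j) + (\<Sum>j\<le>N. h j)"
    unfolding sum.distrib by (subst (2) sum.atMost_Suc_shift) simp
  also have "\<dots> = (\<Sum>j\<le>N. q ^ (j * (j + Suc d)) / (P j * P (N - j) * P (j + Suc d)))"
    by (simp add: gh flip: sum.distrib)
  also have "\<dots> = 1 / (P N * P (N + Suc d))"
    unfolding P_def by (rule Suc.IH)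
  finally have "(\<Sum>j\<le>Suc N. f j) = 1 / (P N * P (N + Suc d)) / (1 - q ^ Suc N)"
    using nz'[of N] by (metis nonzero_eq_divide_eq mult.commute)
  also have "\<dots> = 1 / (P (Suc N) * P (Suc N + d))"
    by (simp add: PS)
  finally show ?case unfolding f_def P_def .
qed

text \<open>Each reciprocal product is replaced by its partial fractions and the two finite sums are
  exchanged; the inner sum over n is then a Durfee rectangle sum. The exponent 3k(k+1)/2 is k(k+1)/2
  from the partial fractions plus k(k+1) from the rectangle.\<close>

lemma bailey_transform:
  fixes q x y :: "'a::field"
  assumes q: "\<And>i. q * q ^ i \<noteq> 1" and xy: "x * y = q"
    and x: "\<And>i. x * q ^ i \<noteq> 1" and y: "\<And>i. y * q ^ i \<noteq> 1"
  shows "(\<Sum>n\<le>N. q ^ (n * (n + 1)) / (qpoch x q (Suc n) * qpoch y q (Suc n)) / qpoch q q (N - n)) =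
    (\<Sum>k\<le>N. (-1) ^ k * q ^ (3 * ((k + 1) * k div 2)) * (1 - q ^ (2 * k + 1)) /
       ((1 - x * q ^ k) * (1 - y * q ^ k)) / (qpoch q q (N - k) * qpoch q q (N + k + 1)))"
proof -
  define P where "P = qpoch q q"
  define w where "w k = (1 - x * q ^ k) * (1 - y * q ^ k)" for k
  define c where "c k = (-1) ^ k * q ^ ((k + 1) * k div 2) * (1 - q ^ (2 * k + 1)) / w k" for k :: nat
  have nz: "P n \<noteq> 0" for n unfolding P_def by (rule qpoch_nonzero) (rule q)
  \<comment> \<open>Here x y = q pays off: with b = q the products (q;q)_k and (q^{k+1};q)_{n+1}
    join to (q;q)_{n+k+1}.\<close>
  have pf: "pf_coeff q q n k / w k = c k / (P (n - k) * P (n + k + 1))" for n k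
  proof -
    have "P (n + k + 1) = P k * qpoch (q * q ^ k) q (Suc n)"
      unfolding P_def qpoch_add[symmetric] by (simp add: algebra_simps)
    then show ?thesis unfolding pf_coeff_def c_def P_def by (simp add: mult_ac)
  qed
  have "(\<Sum>n\<le>N. q ^ (n * (n + 1)) / (qpoch x q (Suc n) * qpoch y q (Suc n)) / P (N - n)) =
      (\<Sum>n\<le>N. \<Sum>k\<le>n. c k * (q ^ (n * (n + 1)) / (P (n - k) * P (N - n) * P (n + k + 1))))"
  proof (rule sum.cong)
    fix n
    have "1 / (qpoch x q (Suc n) * qpoch y q (Suc n)) = (\<Sum>k\<le>n. pf_coeff q q n k / w k)"
      using partial_fractions[of q x y] assms unfolding w_def by simp
    then have "q ^ (n * (n + 1)) / (qpoch x q (Suc n) * qpoch y q (Suc n)) / P (N - n) =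
        q ^ (n * (n + 1)) / P (N - n) * (\<Sum>k\<le>n. c k / (P (n - k) * P (n + k + 1)))"
      unfolding pf by (simp only: divide_inverse mult_1_left mult_1_right mult_ac)
    then show "q ^ (n * (n + 1)) / (qpoch x q (Suc n) * qpoch y q (Suc n)) / P (N - n) =
       (\<Sum>k\<le>n. c k * (q ^ (n * (n + 1)) / (P (n - k) * P (N - n) * P (n + k + 1))))"
      by (simp add: sum_distrib_left mult_ac)
  qed simp
  also have "\<dots> = (\<Sum>k\<le>N. \<Sum>n=k..N. c k * (q ^ (n * (n + 1)) / (P (n - k) * P (N - n) * P (n + k + 1))))"
    unfolding sum.Sigma[OF finite_atMost ballI[OF finite_atMost]] sum.Sigma[OF finite_atMost ballI[OF finite_atLeastAtMost]]
    by (rule sum.reindex_bij_witness[of _ prod.swap prod.swap]) auto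
  also have "\<dots> = (\<Sum>k\<le>N. c k * (q ^ (k * (k + 1)) / (P (N - k) * P (N + k + 1))))"
  proof (rule sum.cong)
    fix k assume "k \<in> {..N}"
    then have k: "k \<le> N" by simp
    \<comment> \<open>With n = j + k one has n(n+1) = k(k+1) + j(j + 2k + 1), a Durfee sum with d =
      2k + 1.\<close>
    have "(\<Sum>n=k..N. q ^ (n * (n + 1)) / (P (n - k) * P (N - n) * P (n + k + 1))) =
       (\<Sum>j\<le>N - k. q ^ ((j + k) * (j + k + 1)) / (P j * P (N - k - j) * P (j + (2 * k + 1))))"
      by (rule sum.reindex_bij_witness[of _ "\<lambda>j. j + k" "\<lambda>n. n - k"]) (use k in \<open>auto simp: algebra_simps mult_2\<close>)
    also have "\<dots> = q ^ (k * (k + 1)) *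
        (\<Sum>j\<le>N - k. q ^ (j * (j + (2 * k + 1))) / (P j * P (N - k - j) * P (j + (2 * k + 1))))"
      unfolding sum_distrib_left
    proof (rule sum.cong)
      fix j
      have "(j + k) * (j + k + 1) = k * (k + 1) + j * (j + (2 * k + 1))"
        by (simp add: algebra_simps)
      then show "q ^ ((j + k) * (j + k + 1)) / (P j * P (N - k - j) * P (j + (2 * k + 1))) =
          q ^ (k * (k + 1)) * (q ^ (j * (j + (2 * k + 1))) / (P j * P (N - k - j) * P (j + (2 * k + 1))))"
        by (simp only: power_add times_divide_eq_right)
    qed simp
    also have "\<dots> = q ^ (k * (k + 1)) / (P (N - k) * P (N - k + (2 * k + 1)))"
      unfolding P_def by (subst durfee_rectangle[OF q]) simp
    also have "N - k + (2 * k + 1) = N + k + 1" using k by simp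
    finally show "(\<Sum>n=k..N. c k * (q ^ (n * (n + 1)) / (P (n - k) * P (N - n) * P (n + k + 1)))) =
        c k * (q ^ (k * (k + 1)) / (P (N - k) * P (N + k + 1)))"
      by (simp only: sum_distrib_left[symmetric])
  qed simp
  also have "\<dots> = (\<Sum>k\<le>N. (-1) ^ k * q ^ (3 * ((k + 1) * k div 2)) * (1 - q ^ (2 * k + 1)) /
       w k / (P (N - k) * P (N + k + 1)))"
  proof (rule sum.cong)
    fix k :: nat
    have "even ((k + 1) * k)" by simp
    then obtain t where t: "(k + 1) * k = 2 * t" by (elim evenE)
    then have "k * (k + 1) = 2 * t" by (simp only: mult.commute)
    with t have "3 * ((k + 1) * k div 2) = (k + 1) * k div 2 + k * (k + 1)" by simp
    then show "c k * (q ^ (k * (k + 1)) / (P (N - k) * P (N + k + 1))) =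
        (-1) ^ k * q ^ (3 * ((k + 1) * k div 2)) * (1 - q ^ (2 * k + 1)) / w k / (P (N - k) * P (N + k + 1))"
      by (simp only: c_def power_add) (simp add: mult_ac)
  qed simp
  finally show ?thesis unfolding P_def w_def .
qed

text \<open>The homogeneous form allows w = q^N later, which centres a product of 2N factors without
  negative powers of q. The induction is the q-Pascal rule, from 1 - q^{M+1} = (1 - q^{M+1-j}) +
  q^{M+1-j} (1 - q^j).\<close>

lemma q_binomial:
  fixes q z w :: "'a::field"
  assumes q: "\<And>i. q * q ^ i \<noteq> 1"
  shows "(\<Prod>i<M. w + z * q ^ i) =
    (\<Sum>j\<le>M. q ^ (j * (j - 1) div 2) * z ^ j * w ^ (M - j) * (qpoch q q M / (qpoch q q j * qpoch q q (M - j))))"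
proof (induction M)
  case 0
  then show ?case by simp
next
  case (Suc M)
  define P where "P = qpoch q q"
  have P0: "P 0 = 1" by (simp add: P_def)
  have PS: "P (Suc n) = P n * (1 - q ^ Suc n)" for n by (simp add: P_def qpoch_Suc)
  have nz: "P n \<noteq> 0" for n unfolding P_def by (rule qpoch_nonzero) (rule q)
  have nz': "1 - q ^ Suc n \<noteq> 0" for n using q[of n] by simp
  define f where "f M j = q ^ (j * (j - 1) div 2) * z ^ j * w ^ (M - j) * (P M / (P j * P (M - j)))" for M j
  have fs: "f (Suc M) j = (if j \<le> M then w * f M j else 0) + (if j = 0 then 0 else z * q ^ M * f M (j - 1))"
    if "j \<le> Suc M" for j
  proof -
    define A where "A = q ^ (j * (j - 1) div 2) * z ^ j * w ^ (Suc M - j) * (P M / (P j * P (Suc M - j)))"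
    have a: "(if j \<le> M then w * f M j else 0) = A * (1 - q ^ (Suc M - j))"
    proof (cases "j \<le> M")
      case True
      then have "Suc M - j = Suc (M - j)" by simp
      then show ?thesis using True nz nz'[of "M - j"] by (simp add: A_def f_def PS field_simps)
    next
      case False
      with that have "j = Suc M" by simp
      then show ?thesis by simp
    qed
    have b: "(if j = 0 then 0 else z * q ^ M * f M (j - 1)) = A * (q ^ (Suc M - j) * (1 - q ^ j))"
    proof (cases j)
      case (Suc i)
      with that have i: "Suc M - Suc i = M - i" "i \<le> M" by auto
      have "Suc i * i div 2 = i * (i - 1) div 2 + i"
        by (cases i) (use triangle_Suc in \<open>auto simp: mult.commute\<close>)
      then have e: "q ^ (Suc i * (Suc i - 1) div 2) * q ^ (M - i) = q ^ (i * (i - 1) div 2) * q ^ M"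
        using i by (simp flip: power_add)
      have "A * (q ^ (Suc M - j) * (1 - q ^ j)) =
        (q ^ (Suc i * (Suc i - 1) div 2) * q ^ (M - i)) * (z ^ Suc i * w ^ (M - i) * (P M / (P (Suc i) * P (M - i)) * (1 - q ^ Suc i)))"
        unfolding A_def Suc i by (simp only: mult_ac)
      also have "P M / (P (Suc i) * P (M - i)) * (1 - q ^ Suc i) = P M / (P i * P (M - i))"
        using nz nz'[of i] by (simp add: PS[of i])
      finally show ?thesis unfolding e by (simp add: Suc f_def mult_ac)
    qed simp
    have "q ^ Suc M = q ^ (Suc M - j) * q ^ j" using that by (simp flip: power_add)
    then have "1 - q ^ Suc M = (1 - q ^ (Suc M - j)) + q ^ (Suc M - j) * (1 - q ^ j)"
      by (simp only: algebra_simps mult_1_left)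
    moreover have "f (Suc M) j = A * (1 - q ^ Suc M)"
      unfolding f_def A_def PS by (simp only: times_divide_eq_right times_divide_eq_left mult_ac)
    ultimately have "f (Suc M) j = A * (1 - q ^ (Suc M - j)) + A * (q ^ (Suc M - j) * (1 - q ^ j))"
      by (simp only: distrib_left)
    then show ?thesis by (simp only: a b)
  qed
  have "(\<Sum>j\<le>Suc M. f (Suc M) j) =
      (\<Sum>j\<le>Suc M. (if j \<le> M then w * f M j else 0) + (if j = 0 then 0 else z * q ^ M * f M (j - 1)))"
    by (rule sum.cong) (use fs in auto)
  also have "\<dots> = (\<Sum>j\<le>M. w * f M j) + (\<Sum>j\<le>M. z * q ^ M * f M j)"
    unfolding sum.distrib by (subst (2) sum.atMost_Suc_shift) simp
  also have "\<dots> = (\<Sum>j\<le>M. f M j) * (w + z * q ^ M)"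
    unfolding sum_distrib_left[symmetric] by (simp only: distrib_left distrib_right mult_ac)
  also have "\<dots> = (\<Prod>i<Suc M. w + z * q ^ i)"
    using Suc.IH unfolding f_def P_def by simp
  finally show ?case unfolding f_def P_def by simp
qed

section \<open>Power series versions and the finite triple product\<close>

declare add_bit_eq_xor [simp del] mult_bit_eq_and [simp del]

lemma fps_to_fls_sum: "fps_to_fls (sum f A) = (\<Sum>x\<in>A. fps_to_fls (f x))"
  by (induction A rule: infinite_finite_induct) auto

lemma fps_to_fls_qpoch:
  fixes a q :: "'a::comm_ring_1 fps"
  shows "fps_to_fls (qpoch a q n) = qpoch (fps_to_fls a) (fps_to_fls q) n"
  by (induction n) (simp_all add: qpoch_Suc fls_times_fps_to_fls fps_to_fls_power)

lemma fps_to_fls_inverse: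
  fixes f :: "'a::field fps"
  assumes "fps_nth f 0 = 1"
  shows "fps_to_fls (inverse f) = inverse (fps_to_fls f)"
  using assms by (subst fls_inverse_fps_to_fls) (auto simp: subdegree_eq_0_iff)

abbreviation qpochX :: "nat \<Rightarrow> nat \<Rightarrow> nat \<Rightarrow> 'a::comm_ring_1 fps" where
  "qpochX a d n \<equiv> qpoch (fps_X ^ a) (fps_X ^ d) n"

lemma qpochX_nth_0: "0 < a \<Longrightarrow> fps_nth (qpochX a d n) 0 = 1"
  by (induction n) (simp_all add: qpoch_Suc)

lemma qpochX_eq_prod: "qpochX a d n = (\<Prod>i<n. 1 - fps_X ^ (a + d * i))"
  by (simp add: qpoch_def power_add power_mult)

lemma fls_X_power_neq_1: "0 < n \<Longrightarrow> (fls_X :: 'a::field fls) ^ n \<noteq> 1"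
  by (metis fls_X_power_nth fls_one_nth neq0_conv of_nat_eq_0_iff zero_neq_one)

text \<open>The identity is transported from the field of Laurent series through the injective
  embedding \<open>fps_to_fls\<close>; inverses correspond because every inverted series has
  constant term 1.\<close>

lemma bailey_transform_X:
  fixes a b :: nat
  assumes "0 < a" "0 < b"
  defines "d \<equiv> a + b"
  defines "P \<equiv> \<lambda>n. inverse (qpochX d d n) :: 'a::field fps"
  shows "(\<Sum>n\<le>N. fps_X ^ (d * (n * (n + 1))) * inverse (qpochX a d (Suc n) * qpochX b d (Suc n)) * P (N - n)) =
    (\<Sum>k\<le>N. (-1) ^ k * fps_X ^ (3 * d * ((k + 1) * k div 2)) * (1 - fps_X ^ (d * (2 * k + 1))) *
       inverse ((1 - fps_X ^ (a + d * k)) * (1 - fps_X ^ (b + d * k))) * (P (N - k) * P (N + k + 1)))"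
    (is "?L = ?R")
proof -
  define q x y :: "'a fls" where "q = fls_X ^ d" and "x = fls_X ^ a" and "y = fls_X ^ b"
  have d: "0 < d" using assms by simp
  have nz: "q * q ^ i \<noteq> 1" "x * q ^ i \<noteq> 1" "y * q ^ i \<noteq> 1" "x * y = q" for i
    unfolding q_def x_def y_def using assms d
    by (simp_all add: power_mult[symmetric] power_add[symmetric] fls_X_power_neq_1)
  have P: "fps_to_fls (P n) = inverse (qpoch q q n)" for n
    using d by (simp add: P_def fps_to_fls_inverse qpochX_nth_0 fps_to_fls_qpoch fps_to_fls_power q_def)
  have xy: "fps_to_fls (inverse (qpochX a d n * qpochX b d n)) = inverse (qpoch x q n * qpoch y q n)" for n
    using assms by (simp add: fps_to_fls_inverse qpochX_nth_0 fps_to_fls_qpoch fps_to_fls_power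
        q_def x_def y_def fls_times_fps_to_fls)
  have w: "fps_to_fls (inverse ((1 - fps_X ^ (a + d * k)) * (1 - fps_X ^ (b + d * k)))) =
      inverse ((1 - x * q ^ k) * (1 - y * q ^ k))" for k
    using assms by (subst fps_to_fls_inverse)
      (simp_all add: fps_to_fls_power q_def x_def y_def fls_times_fps_to_fls power_add power_mult)
  have Xd: "fps_to_fls (fps_X ^ (d * n)) = q ^ n" for n
    by (simp add: fps_to_fls_power q_def power_mult)
  have "fps_to_fls ?L =
      (\<Sum>n\<le>N. q ^ (n * (n + 1)) / (qpoch x q (Suc n) * qpoch y q (Suc n)) / qpoch q q (N - n))"
    unfolding fps_to_fls_sum fls_times_fps_to_fls P xy Xd by (simp only: divide_inverse)
  also have "\<dots> = (\<Sum>k\<le>N. (-1) ^ k * q ^ (3 * ((k + 1) * k div 2)) * (1 - q ^ (2 * k + 1)) /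
       ((1 - x * q ^ k) * (1 - y * q ^ k)) / (qpoch q q (N - k) * qpoch q q (N + k + 1)))"
    by (rule bailey_transform) (use nz in auto)
  also have "\<dots> = fps_to_fls ?R"
  proof -
    have "3 * d * n = d * (3 * n)" for n by simp
    moreover have "fps_to_fls ((-1) ^ k) = (-1 :: 'a fls) ^ k" for k by (simp add: fps_to_fls_power)
    ultimately show ?thesis
      by (simp only: fps_to_fls_sum fls_times_fps_to_fls P w Xd fps_to_fls_minus fps_one_to_fls
        divide_inverse inverse_mult_distrib)
  qed
  finally show ?thesis by simp
qed

lemma prod_lessThan_add: "(\<Prod>i<m + n. f i) = (\<Prod>i<m. f i) * (\<Prod>i<n. f (m + i))" for f :: "nat \<Rightarrow> 'a::comm_monoid_mult"
  by (induction n) (simp_all add: mult.assoc)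

text \<open>The q-binomial theorem for 2N factors with w = q^N and z = X^a. Factors with index at
  least N give the product over a; the lower ones, read in reverse, give the product over b. The
  summation index j becomes k = j - N, and \<open>e k\<close> is the exponent left after cancelling
  a common monomial.\<close>

lemma jacobi_triple_finite:
  fixes a b N :: nat
  assumes "0 < a" "0 < b"
  defines "d \<equiv> a + b"
  defines "P \<equiv> \<lambda>n. inverse (qpochX d d n) :: 'a::field fps"
  defines "e \<equiv> \<lambda>k::int. int d * (k * (k - 1) div 2) + int a * k"
  shows "(\<Prod>i<N. 1 + fps_X ^ (a + d * i)) * (\<Prod>i<N. 1 + fps_X ^ (b + d * i)) =
    (\<Sum>k\<in>{-int N..int N}. fps_X ^ nat (e k) * (qpochX d d (2 * N) * (P (nat (int N + k)) * P (nat (int N - k)))))"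
    (is "?A * ?B = ?R")
proof -
  have d: "0 < d" using assms by simp
  define q z w :: "'a fls" where "q = fls_X ^ d" and "z = fls_X ^ a" and "w = q ^ N"
  have nz: "q * q ^ i \<noteq> 1" for i
    unfolding q_def using d by (simp add: power_mult[symmetric] power_add[symmetric] fls_X_power_neq_1)
  have P: "fps_to_fls (P n) = inverse (qpoch q q n)" for n
    using d by (simp add: P_def fps_to_fls_inverse qpochX_nth_0 fps_to_fls_qpoch fps_to_fls_power q_def)
  have bin: "(\<Prod>i<M. fps_X ^ (d * N) + fps_X ^ (a + d * i)) =
     (\<Sum>j\<le>M. fps_X ^ (d * (j * (j - 1) div 2) + a * j + d * N * (M - j)) * (qpochX d d M * (P j * P (M - j))))"
    (is "?l = ?r") for M
  proof -
    have prd: "fps_to_fls ?l = (\<Prod>i<M. w + z * q ^ i)"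
      by (induction M) (simp_all add: fls_times_fps_to_fls fps_to_fls_power w_def z_def q_def power_add power_mult)
    have X: "fps_to_fls (fps_X ^ (d * (j * (j - 1) div 2) + a * j + d * N * (M - j))) =
        q ^ (j * (j - 1) div 2) * z ^ j * w ^ (M - j)" for j
      by (simp add: fps_to_fls_power fls_times_fps_to_fls q_def z_def w_def power_add flip: power_mult)
    have Q: "fps_to_fls (qpochX d d M) = qpoch q q M"
      by (simp add: fps_to_fls_qpoch fps_to_fls_power q_def)
    have "fps_to_fls ?l = fps_to_fls ?r"
      unfolding prd q_binomial[OF nz] fps_to_fls_sum fls_times_fps_to_fls P X Q
      by (simp only: divide_inverse inverse_mult_distrib mult_ac)
    then show ?thesis by simp
  qed
  \<comment> \<open>Total degree of the monomials pulled out: a + d i from the factors with i < N,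
    and d N from each of the N remaining ones.\<close>
  define big where "big = d * (N * (N - 1) div 2) + a * N + d * N * N"
  have up: "(\<Prod>i<n. fps_X ^ (d * N) + fps_X ^ (a + d * (N + i))) = (fps_X ^ (d * N * n) * (\<Prod>i<n. 1 + fps_X ^ (a + d * i)) :: 'a fps)" for n
    by (induction n) (simp_all add: power_add algebra_simps)
  have lo: "(\<Prod>i<n. fps_X ^ (d * N) + fps_X ^ (a + d * i)) =
     (fps_X ^ (d * (n * (n - 1) div 2) + a * n) * (\<Prod>i<n. 1 + fps_X ^ (b + d * (N - 1 - i))) :: 'a fps)" if "n \<le> N" for n
    using that
  proof (induction n)
    case 0
    then show ?case by simp
  next
    case (Suc n)
    have e1: "Suc n * (Suc n - 1) div 2 = n * (n - 1) div 2 + n"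
      by (cases n) (use triangle_Suc in \<open>auto simp: mult.commute\<close>)
    have "d * N = (a + d * n) + (b + d * (N - 1 - n))"
    proof -
      obtain r where "N = Suc n + r" using Suc.prems le_Suc_ex by blast
      then show ?thesis by (simp add: d_def algebra_simps)
    qed
    then have e2: "(fps_X :: 'a fps) ^ (d * N) = fps_X ^ (a + d * n) * fps_X ^ (b + d * (N - 1 - n))"
      by (simp only: power_add)
    have e3: "d * (Suc n * (Suc n - 1) div 2) + a * Suc n = (d * (n * (n - 1) div 2) + a * n) + (a + d * n)"
      unfolding e1 by (simp add: algebra_simps)
    have "(fps_X ^ (d * N) + fps_X ^ (a + d * n) :: 'a fps) = fps_X ^ (a + d * n) * (1 + fps_X ^ (b + d * (N - 1 - n)))"
      unfolding e2 by (simp only: distrib_left mult_1_right add.commute)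
    moreover have "(\<Prod>i<n. fps_X ^ (d * N) + fps_X ^ (a + d * i)) =
       (fps_X ^ (d * (n * (n - 1) div 2) + a * n) * (\<Prod>i<n. 1 + fps_X ^ (b + d * (N - 1 - i))) :: 'a fps)"
      using Suc by simp
    ultimately show ?case
      unfolding prod.lessThan_Suc e3 power_add[of fps_X "d * (n * (n - 1) div 2) + a * n" "a + d * n"]
      by (simp only: mult_ac)
  qed
  have "(\<Prod>i<2 * N. fps_X ^ (d * N) + fps_X ^ (a + d * i)) = fps_X ^ big * (?A * ?B)"
  proof -
    have "(\<Prod>i<2 * N. fps_X ^ (d * N) + fps_X ^ (a + d * i)) =
       (\<Prod>i<N. fps_X ^ (d * N) + fps_X ^ (a + d * i)) * (\<Prod>i<N. fps_X ^ (d * N) + fps_X ^ (a + d * (N + i)) :: 'a fps)"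
      by (simp only: mult_2 prod_lessThan_add)
    also have "(\<Prod>i<N. 1 + fps_X ^ (b + d * (N - 1 - i)) :: 'a fps) = ?B"
      by (rule prod.reindex_bij_witness[of _ "\<lambda>i. N - 1 - i" "\<lambda>i. N - 1 - i"]) auto
    then have "(\<Prod>i<N. fps_X ^ (d * N) + fps_X ^ (a + d * i)) = fps_X ^ (d * (N * (N - 1) div 2) + a * N) * ?B"
      using lo[of N] by simp
    finally show ?thesis unfolding up big_def by (simp add: power_add mult_ac)
  qed
  also have "(\<Prod>i<2 * N. fps_X ^ (d * N) + fps_X ^ (a + d * i)) = fps_X ^ big * ?R"
    unfolding bin sum_distrib_left
  proof (rule sum.reindex_bij_witness[of _ "\<lambda>k. nat (int N + k)" "\<lambda>j. int j - int N"])
    fix j assume "j \<in> {..2 * N}"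
    then have j: "j \<le> 2 * N" by simp
    define k where "k = int j - int N"
    have "d * (j * (j - 1) div 2) + a * j + d * N * (2 * N - j) = big + nat (e k)"
    proof -
      have dv: "int (j * (j - 1) div 2) = int j * (int j - 1) div 2" for j
        by (cases j) (auto simp: zdiv_int algebra_simps)
      have t: "int j * (int j - 1) div 2 = int N * (int N - 1) div 2 + int N * k + k * (k - 1) div 2"
      proof -
        have "int j * (int j - 1) = int N * (int N - 1) + 2 * (int N * k) + k * (k - 1)"
          by (simp add: k_def algebra_simps)
        moreover obtain p where "int N * (int N - 1) = 2 * p" using evenE[of "int N * (int N - 1)"] by auto
        moreover obtain r where "k * (k - 1) = 2 * r" using evenE[of "k * (k - 1)"] by auto
        ultimately show ?thesis by simp
      qed
      \<comment> \<open>Since d = a + b, \<open>e k\<close> equals a k(k+1)/2 + b k(k-1)/2, so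
        \<open>nat\<close> loses nothing.\<close>
      have e0: "0 \<le> e k"
      proof -
        have "0 \<le> k * (k - 1)" "0 \<le> k * (k + 1)"
          by (cases "k > 0"; cases "k < 0"; auto intro: mult_nonpos_nonpos)+
        moreover have "k * (k - 1) div 2 + k = k * (k + 1) div 2"
        proof -
          have "k * (k + 1) = k * (k - 1) + k * 2" by (simp add: algebra_simps)
          then show ?thesis by simp
        qed
        moreover have "e k = int a * (k * (k - 1) div 2 + k) + int b * (k * (k - 1) div 2)"
          by (simp add: e_def d_def algebra_simps)
        ultimately show ?thesis by (simp add: pos_imp_zdiv_nonneg_iff)
      qed
      have "int (d * (j * (j - 1) div 2) + a * j + d * N * (2 * N - j)) =
         int d * (int j * (int j - 1) div 2) + int a * int j + int d * int N * (2 * int N - int j)"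
        using j by (simp only: of_nat_add of_nat_mult dv of_nat_diff of_nat_numeral)
      also have "\<dots> = int big + e k"
        unfolding t big_def of_nat_add of_nat_mult dv e_def by (simp add: k_def algebra_simps)
      finally show ?thesis using e0 by linarith
    qed
    moreover have "nat (int N + k) = j" "nat (int N - k) = 2 * N - j"
      using j by (auto simp: k_def)
    ultimately show "fps_X ^ big * (fps_X ^ nat (e (int j - int N)) * (qpochX d d (2 * N) *
           (P (nat (int N + (int j - int N))) * P (nat (int N - (int j - int N)))))) =
         fps_X ^ (d * (j * (j - 1) div 2) + a * j + d * N * (2 * N - j)) *
         (qpochX d d (2 * N) * (P j * P (2 * N - j)))"
      unfolding k_def[symmetric] by (simp add: power_add mult_ac)
  qed auto
  finally show ?thesis by (simp add: mult_cancel_left)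
qed

section \<open>Passage to the limit\<close>

lemma fps_tendsto_mult:
  fixes f g :: "'b \<Rightarrow> 'a::ring fps"
  assumes "(f \<longlongrightarrow> a) F" "(g \<longlongrightarrow> b) F"
  shows "((\<lambda>x. f x * g x) \<longlongrightarrow> a * b) F"
proof (rule tendsto_fpsI)
  fix n
  have "\<forall>\<^sub>F x in F. \<forall>i\<in>{..n}. fps_nth (f x) i = fps_nth a i \<and> fps_nth (g x) i = fps_nth b i"
    using assms by (intro eventually_ball_finite) (auto simp: tendsto_fps_iff intro: eventually_conj)
  then show "\<forall>\<^sub>F x in F. fps_nth (f x * g x) n = fps_nth (a * b) n"
    by eventually_elim (auto simp: fps_mult_nth intro!: sum.cong)
qed

lemma fps_tendsto_inverse:
  fixes f :: "'b \<Rightarrow> 'a::field fps"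
  assumes f: "(f \<longlongrightarrow> a) F" and a: "fps_nth a 0 \<noteq> 0"
  shows "((\<lambda>x. inverse (f x)) \<longlongrightarrow> inverse a) F"
proof (rule tendsto_fpsI)
  fix n
  have "\<forall>\<^sub>F x in F. \<forall>i\<in>{..n}. fps_nth (f x) i = fps_nth a i"
    using f by (intro eventually_ball_finite) (auto simp: tendsto_fps_iff)
  then show "\<forall>\<^sub>F x in F. fps_nth (inverse (f x)) n = fps_nth (inverse a) n"
  proof eventually_elim
    case (elim x)
    then have "fps_nth (f x) 0 \<noteq> 0" using a by auto
    then have 1: "inverse (f x) * f x = 1" and 2: "inverse a * a = 1"
      using a by (auto intro: inverse_mult_eq_1)
    have "inverse (f x) - inverse a = inverse (f x) * (inverse a * a) - (inverse (f x) * f x) * inverse a"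
      by (simp only: 1 2 mult_1_left mult_1_right)
    then have "inverse (f x) - inverse a = (a - f x) * (inverse (f x) * inverse a)"
      by (simp add: algebra_simps)
    moreover have "fps_nth ((a - f x) * (inverse (f x) * inverse a)) n = 0"
      unfolding fps_mult_nth by (rule sum.neutral) (use elim in auto)
    ultimately have "fps_nth (inverse (f x) - inverse a) n = 0" by simp
    then show ?case by simp
  qed
qed

text \<open>Meaningful only if each coefficient is nonzero for finitely many members of the family; otherwise
  that coefficient of the sum is \<open>0\<close>.\<close>
definition fps_sum :: "('b \<Rightarrow> 'a::comm_ring_1 fps) \<Rightarrow> 'b set \<Rightarrow> 'a fps" where
  "fps_sum c S = Abs_fps (\<lambda>m. \<Sum>k | k \<in> S \<and> fps_nth (c k) m \<noteq> 0. fps_nth (c k) m)"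

lemma fps_sum_nth_eq:
  assumes "finite A" "A \<subseteq> S" "\<And>k. k \<in> S \<Longrightarrow> fps_nth (c k) m \<noteq> 0 \<Longrightarrow> k \<in> A"
  shows "fps_nth (fps_sum c S) m = (\<Sum>k\<in>A. fps_nth (c k) m)"
  unfolding fps_sum_def using assms by (simp, intro sum.mono_neutral_left) auto

text \<open>A Tannery theorem for the X-adic topology. The correction factors tend to 1 for each k
  separately; no uniformity is required because only finitely many k contribute to the coefficients
  up to a given degree, and for these all factors agree with 1 up to that degree once N is
  large.\<close>

lemma fps_sum_tendsto:
  fixes c :: "'b \<Rightarrow> 'a::comm_ring_1 fps"
  assumes I: "\<And>N. finite (I N)" "\<And>N. I N \<subseteq> S" "\<And>k. k \<in> S \<Longrightarrow> \<forall>\<^sub>F N in sequentially. k \<in> I N"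
    and c: "\<And>m. finite {k\<in>S. fps_nth (c k) m \<noteq> 0}"
    and u: "\<And>k. k \<in> S \<Longrightarrow> (\<lambda>N. u N k) \<longlonglongrightarrow> 1"
  shows "(\<lambda>N. \<Sum>k\<in>I N. c k * u N k) \<longlonglongrightarrow> fps_sum c S"
proof (rule tendsto_fpsI)
  fix m
  define K where "K = (\<Union>i\<in>{..m}. {k\<in>S. fps_nth (c k) i \<noteq> 0})"
  have K: "finite K" "K \<subseteq> S" using c by (auto simp: K_def)
  have Kc: "fps_nth (c k) i = 0" if "k \<in> S" "k \<notin> K" "i \<le> m" for k i
    using that by (auto simp: K_def)
  have "\<forall>\<^sub>F N in sequentially. \<forall>k\<in>K. k \<in> I N"
    using K I(3) by (intro eventually_ball_finite) auto
  moreover have "\<forall>\<^sub>F N in sequentially. \<forall>k\<in>K. \<forall>i\<in>{..m}. fps_nth (u N k) i = fps_nth 1 i"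
  proof (intro eventually_ball_finite ballI)
    fix k i assume "k \<in> K"
    then have "(\<lambda>N. u N k) \<longlonglongrightarrow> 1" using K u by auto
    then show "\<forall>\<^sub>F N in sequentially. fps_nth (u N k) i = fps_nth 1 i"
      unfolding tendsto_fps_iff by blast
  qed (use K in auto)
  ultimately show "\<forall>\<^sub>F N in sequentially. fps_nth (\<Sum>k\<in>I N. c k * u N k) m = fps_nth (fps_sum c S) m"
  proof eventually_elim
    case (elim N)
    have "fps_nth (\<Sum>k\<in>I N. c k * u N k) m = (\<Sum>k\<in>I N. fps_nth (c k * u N k) m)"
      by (simp add: fps_sum_nth)
    also have "\<dots> = (\<Sum>k\<in>K. fps_nth (c k * u N k) m)"
    proof (rule sum.mono_neutral_right)
      show "\<forall>k\<in>I N - K. fps_nth (c k * u N k) m = 0"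
      proof
        fix k assume "k \<in> I N - K"
        then have "fps_nth (c k) i = 0" if "i \<le> m" for i using I(2) Kc that by auto
        then show "fps_nth (c k * u N k) m = 0" by (simp add: fps_mult_nth)
      qed
    qed (use elim I in auto)
    also have "\<dots> = (\<Sum>k\<in>K. fps_nth (c k) m)"
    proof (rule sum.cong)
      fix k assume "k \<in> K"
      then have "fps_nth (c k * u N k) m = fps_nth (c k * 1) m"
        unfolding fps_mult_nth using elim by (intro sum.cong) auto
      then show "fps_nth (c k * u N k) m = fps_nth (c k) m" by simp
    qed simp
    also have "\<dots> = fps_nth (fps_sum c S) m"
      using K Kc by (intro fps_sum_nth_eq[symmetric]) auto
    finally show ?case .
  qed
qed

section \<open>Infinite products as coefficientwise limits\<close>

definition qpochX_inf :: "nat \<Rightarrow> nat \<Rightarrow> 'a::comm_ring_1 fps" where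
  "qpochX_inf a d = Abs_fps (\<lambda>m. fps_nth (qpochX a d (Suc m)) m)"

text \<open>A factor with index n > m differs from 1 only in degree a + d n > m, so it cannot affect
  the coefficient of degree m.\<close>

lemma qpochX_nth_stable:
  assumes "0 < d" "0 < a" "m < n"
  shows "fps_nth (qpochX a d n :: 'a::comm_ring_1 fps) m = fps_nth (qpochX a d (Suc m)) m"
  using assms(3)
proof (induction n)
  case (Suc n)
  show ?case
  proof (cases "n = m")
    case False
    with Suc have "m < n" by simp
    have "n \<le> d * n" using assms by simp
    then have "m < a + d * n" using \<open>m < n\<close> by linarith
    have "qpochX a d (Suc n) = qpochX a d n - fps_X ^ (a + d * n) * (qpochX a d n :: 'a fps)"
      by (simp add: qpochX_eq_prod algebra_simps)
    then have "fps_nth (qpochX a d (Suc n) :: 'a fps) m = fps_nth (qpochX a d n) m"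
      using \<open>m < a + d * n\<close> by (simp only: fps_sub_nth fps_X_power_mult_nth) simp
    then show ?thesis using Suc.IH \<open>m < n\<close> by simp
  qed simp
qed simp

lemma qpochX_tendsto:
  assumes "0 < a" "0 < d"
  shows "qpochX a d \<longlonglongrightarrow> (qpochX_inf a d :: 'a::comm_ring_1 fps)"
proof (rule tendsto_fpsI)
  fix m
  have "fps_nth (qpochX a d n :: 'a fps) m = fps_nth (qpochX_inf a d) m" if "m < n" for n
    using qpochX_nth_stable[OF assms(2,1) that] by (simp add: qpochX_inf_def)
  then show "\<forall>\<^sub>F n in sequentially. fps_nth (qpochX a d n :: 'a fps) m = fps_nth (qpochX_inf a d) m"
    unfolding eventually_sequentially using less_eq_Suc_le by blast
qed

lemma qpochX_inf_nth_0: "0 < a \<Longrightarrow> fps_nth (qpochX_inf a d) 0 = 1"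
  unfolding qpochX_inf_def by (simp add: qpochX_nth_0 del: One_nat_def)

abbreviation euler :: "nat \<Rightarrow> 'a::comm_ring_1 fps" where
  "euler d \<equiv> qpochX_inf d d"

lemma euler_inverse_tendsto:
  assumes "0 < d" "filterlim f sequentially sequentially"
  shows "(\<lambda>N. euler d * inverse (qpochX d d (f N))) \<longlonglongrightarrow> (1 :: 'a::field fps)"
proof -
  have "(\<lambda>N. inverse (qpochX d d (f N))) \<longlonglongrightarrow> (inverse (euler d) :: 'a fps)"
    using assms by (intro fps_tendsto_inverse filterlim_compose[OF qpochX_tendsto]) (auto simp: qpochX_inf_nth_0)
  then have "(\<lambda>N. euler d * inverse (qpochX d d (f N))) \<longlonglongrightarrow> euler d * (inverse (euler d) :: 'a fps)"
    by (intro fps_tendsto_mult tendsto_const)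
  then show ?thesis
    using assms by (simp add: inverse_mult_eq_1' qpochX_inf_nth_0)
qed

lemma bit_fps_2 [simp]: "(2 :: bit fps) = 0"
  by (simp add: numeral_fps_const)

lemma bit_fps_add_self [simp]: "(f :: bit fps) + f = 0"
  unfolding mult_2[symmetric] by simp

lemma bit_fps_uminus [simp]: "- (f :: bit fps) = f"
  by (simp only: neg_eq_iff_add_eq_0 bit_fps_add_self)

lemma bit_fps_minus [simp]: "(f :: bit fps) - g = f + g"
  unfolding diff_conv_add_uminus by simp

lemma filterlim_times_sequentially:
  assumes "0 < c"
  shows "filterlim (\<lambda>N. c * N) sequentially (sequentially :: nat filter)"
  by (rule filterlim_subseq) (use assms in \<open>simp add: strict_mono_def\<close>)

text \<open>In characteristic 2 the factors 1 + X^i of the finite identity are the factors 1 - X^i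
  of \<open>qpoch\<close>. Multiplying by \<open>euler d\<close> turns the q-binomial coefficients
  into factors \<open>u N k\<close> that tend to 1.\<close>

lemma jacobi_triple_bit:
  assumes "0 < a" "0 < b"
  defines "e \<equiv> \<lambda>k::int. int (a + b) * (k * (k - 1) div 2) + int a * k"
  assumes fin: "\<And>m. finite {k. nat (e k) = m}"
  shows "qpochX_inf a (a + b) * qpochX_inf b (a + b) * euler (a + b) =
      fps_sum (\<lambda>k. (fps_X :: bit fps) ^ nat (e k)) UNIV"
proof -
  define d where "d = a + b"
  have d: "0 < d" using assms by (simp add: d_def)
  define P where "P n = inverse (qpochX d d n :: bit fps)" for n
  define u where "u N k = qpochX d d (2 * N) * P (nat (int N + k)) * (euler d * P (nat (int N - k)))" for N k
  have shift: "filterlim (\<lambda>N. nat (int N + k)) sequentially sequentially" for k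
    unfolding filterlim_at_top
  proof
    fix Z :: nat
    show "\<forall>\<^sub>F N in sequentially. Z \<le> nat (int N + k)"
      unfolding eventually_sequentially by (rule exI[of _ "Z + nat \<bar>k\<bar>"]) auto
  qed
  have u: "(\<lambda>N. u N k) \<longlonglongrightarrow> 1" for k
  proof -
    have "(\<lambda>N. qpochX d d (2 * N)) \<longlonglongrightarrow> (euler d :: bit fps)"
      using d by (intro filterlim_compose[OF qpochX_tendsto] filterlim_times_sequentially) auto
    moreover have "(\<lambda>N. P (nat (int N + k))) \<longlonglongrightarrow> inverse (euler d)"
      unfolding P_def using d shift by (intro fps_tendsto_inverse filterlim_compose[OF qpochX_tendsto])
        (auto simp: qpochX_inf_nth_0)
    moreover have "(\<lambda>N. euler d * P (nat (int N - k))) \<longlonglongrightarrow> 1"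
      unfolding P_def using d shift[of "-k"] by (intro euler_inverse_tendsto) auto
    ultimately have "(\<lambda>N. u N k) \<longlonglongrightarrow> euler d * inverse (euler d) * 1"
      unfolding u_def by (intro fps_tendsto_mult)
    then show ?thesis using d by (simp add: inverse_mult_eq_1' qpochX_inf_nth_0)
  qed
  have "(\<lambda>N. \<Sum>k\<in>{-int N..int N}. fps_X ^ nat (e k) * u N k) \<longlonglongrightarrow> fps_sum (\<lambda>k. (fps_X :: bit fps) ^ nat (e k)) UNIV"
  proof (rule fps_sum_tendsto)
    fix k :: int
    show "\<forall>\<^sub>F N in sequentially. k \<in> {-int N..int N}"
      unfolding eventually_sequentially by (rule exI[of _ "nat \<bar>k\<bar>"]) auto
  next
    fix m
    show "finite {k \<in> UNIV. fps_nth ((fps_X :: bit fps) ^ nat (e k)) m \<noteq> 0}"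
      by (rule finite_subset[OF _ fin[of m]]) (auto simp: fps_X_power_nth split: if_splits)
  qed (use u in auto)
  moreover have "(\<Sum>k\<in>{-int N..int N}. fps_X ^ nat (e k) * u N k) =
      qpochX a d N * qpochX b d N * euler d" for N
  proof -
    have eq: "qpochX a d N * qpochX b d N = (\<Sum>k\<in>{-int N..int N}. fps_X ^ nat (e k) *
        (qpochX d d (2 * N) * (P (nat (int N + k)) * P (nat (int N - k)))))"
      using jacobi_triple_finite[where 'a = bit, OF assms(1,2), of N]
      by (simp add: qpochX_eq_prod d_def e_def P_def)
    show ?thesis unfolding eq sum_distrib_right u_def by (simp only: mult_ac)
  qed
  moreover have "(\<lambda>N. qpochX a d N * qpochX b d N * euler d) \<longlonglongrightarrow>
      qpochX_inf a d * qpochX_inf b d * (euler d :: bit fps)"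
    using assms d by (intro fps_tendsto_mult qpochX_tendsto tendsto_const)
  ultimately have "qpochX_inf a d * qpochX_inf b d * euler d = fps_sum (\<lambda>k. (fps_X :: bit fps) ^ nat (e k)) UNIV"
    by (simp only: LIMSEQ_unique)
  then show ?thesis unfolding d_def .
qed

section \<open>Euler products modulo 2\<close>

text \<open>The multiples of d sorted by residue modulo 3d. The next two lemmas sort them modulo 2d,
  and the odd multiples modulo 4d.\<close>

lemma qpochX_triple:
  "qpochX d (3 * d) N * qpochX (2 * d) (3 * d) N * qpochX (3 * d) (3 * d) N = (qpochX d d (3 * N) :: 'a::comm_ring_1 fps)"
proof (induction N)
  case (Suc N)
  have "3 * Suc N = Suc (Suc (Suc (3 * N)))" by simp
  moreover have "d + 3 * d * N = d + d * (3 * N)" "2 * d + 3 * d * N = d + d * Suc (3 * N)"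
    "3 * d + 3 * d * N = d + d * Suc (Suc (3 * N))"
    by (simp_all add: algebra_simps)
  ultimately show ?case
    using Suc.IH unfolding qpochX_eq_prod by (simp only: prod.lessThan_Suc mult_ac)
qed simp

lemma qpochX_double:
  "qpochX d (2 * d) N * qpochX (2 * d) (2 * d) N = (qpochX d d (2 * N) :: 'a::comm_ring_1 fps)"
proof (induction N)
  case (Suc N)
  have "2 * Suc N = Suc (Suc (2 * N))" by simp
  moreover have "d + 2 * d * N = d + d * (2 * N)" "2 * d + 2 * d * N = d + d * Suc (2 * N)"
    by (simp_all add: algebra_simps)
  ultimately show ?case
    using Suc.IH unfolding qpochX_eq_prod by (simp only: prod.lessThan_Suc mult_ac)
qed simp

lemma qpochX_split_odd:
  "qpochX d (4 * d) N * qpochX (3 * d) (4 * d) N = (qpochX d (2 * d) (2 * N) :: 'a::comm_ring_1 fps)"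
proof (induction N)
  case (Suc N)
  have "2 * Suc N = Suc (Suc (2 * N))" by simp
  moreover have "d + 4 * d * N = d + 2 * d * (2 * N)" "3 * d + 4 * d * N = d + 2 * d * Suc (2 * N)"
    by (simp_all add: algebra_simps)
  ultimately show ?case
    using Suc.IH unfolding qpochX_eq_prod by (simp only: prod.lessThan_Suc mult_ac)
qed simp

lemma euler_triple:
  assumes "0 < d"
  shows "qpochX_inf d (3 * d) * qpochX_inf (2 * d) (3 * d) * euler (3 * d) = (euler d :: 'a::comm_ring_1 fps)"
proof (rule LIMSEQ_unique)
  show "(\<lambda>N. qpochX d d (3 * N)) \<longlonglongrightarrow> (euler d :: 'a fps)"
    using assms by (intro filterlim_compose[OF qpochX_tendsto] filterlim_times_sequentially) auto
  show "(\<lambda>N. qpochX d d (3 * N)) \<longlonglongrightarrow>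
      (qpochX_inf d (3 * d) * qpochX_inf (2 * d) (3 * d) * euler (3 * d) :: 'a fps)"
    unfolding qpochX_triple[symmetric] using assms by (intro fps_tendsto_mult qpochX_tendsto) auto
qed

lemma euler_double:
  assumes "0 < d"
  shows "qpochX_inf d (2 * d) * euler (2 * d) = (euler d :: 'a::comm_ring_1 fps)"
proof (rule LIMSEQ_unique)
  show "(\<lambda>N. qpochX d d (2 * N)) \<longlonglongrightarrow> (euler d :: 'a fps)"
    using assms by (intro filterlim_compose[OF qpochX_tendsto] filterlim_times_sequentially) auto
  show "(\<lambda>N. qpochX d d (2 * N)) \<longlonglongrightarrow> (qpochX_inf d (2 * d) * euler (2 * d) :: 'a fps)"
    unfolding qpochX_double[symmetric] using assms by (intro fps_tendsto_mult qpochX_tendsto) auto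
qed

lemma qpochX_inf_split_odd:
  assumes "0 < d"
  shows "qpochX_inf d (4 * d) * qpochX_inf (3 * d) (4 * d) = (qpochX_inf d (2 * d) :: 'a::comm_ring_1 fps)"
proof (rule LIMSEQ_unique)
  show "(\<lambda>N. qpochX d (2 * d) (2 * N)) \<longlonglongrightarrow> (qpochX_inf d (2 * d) :: 'a fps)"
    using assms by (intro filterlim_compose[OF qpochX_tendsto] filterlim_times_sequentially) auto
  show "(\<lambda>N. qpochX d (2 * d) (2 * N)) \<longlonglongrightarrow> (qpochX_inf d (4 * d) * qpochX_inf (3 * d) (4 * d) :: 'a fps)"
    unfolding qpochX_split_odd[symmetric] using assms by (intro fps_tendsto_mult qpochX_tendsto) auto
qed

text \<open>Frobenius applied to every factor: (1 + y)^2 = 1 + y^2 in characteristic 2.\<close>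

lemma euler_square_bit:
  assumes "0 < d"
  shows "(euler d)\<^sup>2 = (euler (2 * d) :: bit fps)"
proof (rule LIMSEQ_unique)
  have sq: "qpochX d d N * qpochX d d N = (qpochX (2 * d) (2 * d) N :: bit fps)" for N
  proof (induction N)
    case (Suc N)
    have "(1 + fps_X ^ (d + d * N)) * (1 + fps_X ^ (d + d * N)) = 1 + (fps_X ^ (d + d * N) * fps_X ^ (d + d * N) :: bit fps)"
      by (simp add: algebra_simps flip: mult_2)
    also have "fps_X ^ (d + d * N) * fps_X ^ (d + d * N) = (fps_X ^ (2 * d + 2 * d * N) :: bit fps)"
      by (simp add: algebra_simps flip: power_add)
    finally have sq: "(1 + fps_X ^ (d + d * N)) * (1 + fps_X ^ (d + d * N)) = (1 + fps_X ^ (2 * d + 2 * d * N) :: bit fps)" .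
    have S: "qpochX c c (Suc N) = (qpochX c c N * (1 + fps_X ^ (c + c * N)) :: bit fps)" for c
      by (simp add: qpochX_eq_prod)
    show ?case unfolding S Suc.IH[symmetric] sq[symmetric] by (simp only: mult_ac)
  qed simp
  show "qpochX (2 * d) (2 * d) \<longlonglongrightarrow> (euler (2 * d) :: bit fps)"
    using assms by (intro qpochX_tendsto) auto
  have "(\<lambda>N. qpochX d d N * qpochX d d N) \<longlonglongrightarrow> (euler d * euler d :: bit fps)"
    using assms by (intro fps_tendsto_mult qpochX_tendsto) auto
  then show "qpochX (2 * d) (2 * d) \<longlonglongrightarrow> ((euler d)\<^sup>2 :: bit fps)"
    unfolding sq power2_eq_square .
qed

lemma euler_power4_bit:
  assumes "0 < d"
  shows "euler (4 * d) = (euler d :: bit fps) ^ 4"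
proof -
  have "(euler d :: bit fps) ^ 4 = ((euler d)\<^sup>2)\<^sup>2" by (simp flip: power_mult)
  then show ?thesis using assms by (simp add: euler_square_bit)
qed

text \<open>The theta series of the exponent function e, reduced modulo 2: coefficient m is the
  parity of the number of representations of m. An infinite fibre would count as 0, so finiteness of
  fibres is supplied wherever it matters.\<close>

definition bit_theta :: "('a \<Rightarrow> int) \<Rightarrow> 'a set \<Rightarrow> bit fps" where
  "bit_theta e S = Abs_fps (\<lambda>m. of_nat (card {x\<in>S. e x = int m}))"

lemma fps_sum_X_power:
  assumes "\<And>x. x \<in> S \<Longrightarrow> 0 \<le> e x" "\<And>m. finite {x\<in>S. e x = int m}"
  shows "fps_sum (\<lambda>x. fps_X ^ nat (e x)) S = bit_theta e S"
proof (rule fps_ext)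
  fix m
  have eq: "nat (e x) = m \<longleftrightarrow> e x = int m" if "x \<in> S" for x using assms(1)[OF that] by auto
  have "fps_nth (fps_sum (\<lambda>x. (fps_X :: bit fps) ^ nat (e x)) S) m =
      (\<Sum>x | x \<in> S \<and> e x = int m. fps_nth (fps_X ^ nat (e x)) m)"
    by (rule fps_sum_nth_eq) (use assms eq in \<open>auto simp: fps_X_power_nth split: if_splits\<close>)
  also have "\<dots> = (\<Sum>x | x \<in> S \<and> e x = int m. 1)"
    by (rule sum.cong) (use eq in \<open>auto simp: fps_X_power_nth\<close>)
  finally show "fps_nth (fps_sum (\<lambda>x. (fps_X :: bit fps) ^ nat (e x)) S) m = fps_nth (bit_theta e S) m"
    by (simp add: bit_theta_def)
qed

lemma jacobi_triple_theta:
  assumes "0 < a" "0 < b"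
  assumes e: "\<And>k::int. e k = int (a + b) * (k * (k - 1) div 2) + int a * k"
  assumes ge: "\<And>k. \<bar>k\<bar> \<le> e k"
  shows "qpochX_inf a (a + b) * qpochX_inf b (a + b) * euler (a + b) = bit_theta e UNIV"
proof -
  have fin: "finite {k \<in> UNIV. e k = int m}" for m
    by (rule finite_subset[of _ "{-int m..int m}"]) (use ge in \<open>auto simp: abs_le_iff\<close>, (smt (verit) ge)+)
  have ge0: "0 \<le> e k" for k using ge[of k] by linarith
  have "fps_sum (\<lambda>k. fps_X ^ nat (e k)) UNIV = bit_theta e UNIV"
    using fin ge0 by (intro fps_sum_X_power) auto
  moreover have "finite {k. nat (e k) = m}" for m
    by (rule finite_subset[OF _ fin[of m]]) (use ge0 in auto)
  ultimately show ?thesis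
    using jacobi_triple_bit[OF assms(1,2)] unfolding e[symmetric] by simp
qed

text \<open>The triple product with a = d and b = 2d: its three factors are the residue classes of
  the multiples of d modulo 3d.\<close>

lemma euler_pentagonal:
  assumes d: "0 < d"
  shows "euler d = bit_theta (\<lambda>k::int. int d * (k * (3 * k - 1) div 2)) UNIV"
proof -
  let ?e = "\<lambda>k::int. int d * (k * (3 * k - 1) div 2)"
  have "qpochX_inf d (d + 2 * d) * qpochX_inf (2 * d) (d + 2 * d) * euler (d + 2 * d) = bit_theta ?e UNIV"
  proof (rule jacobi_triple_theta)
    fix k :: int
    have "k * (3 * k - 1) = 3 * (k * (k - 1)) + k * 2" by (simp add: algebra_simps)
    moreover obtain r where r: "k * (k - 1) = 2 * r" using evenE[of "k * (k - 1)"] by auto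
    ultimately have h: "k * (3 * k - 1) div 2 = 3 * r + k" by simp
    show "?e k = int (d + 2 * d) * (k * (k - 1) div 2) + int d * k"
      unfolding h r by (simp add: algebra_simps)
    have "0 \<le> k * (k - 1)" "0 \<le> k * (k + 1)"
      by (cases "k > 0"; cases "k < 0"; auto intro: mult_nonpos_nonpos)+
    then have "\<bar>k\<bar> \<le> 3 * r + k"
      using r by (simp add: algebra_simps)
    also have "\<dots> \<le> int d * (3 * r + k)"
      using d calculation mult_right_mono[of 1 "int d" "3 * r + k"] by fastforce
    finally show "\<bar>k\<bar> \<le> ?e k" unfolding h .
  qed (use d in auto)
  then show ?thesis using euler_triple[OF d, where 'a = bit] by simp
qed

text \<open>The triple product with a = d and b = 3d gives O E_{4d}, where O is the product over odd
  multiples of d. Modulo 2, O E_d^2 = O E_{2d} = E_d and E_{4d} = E_d^4, so this is E_d^3. As 2k^2 -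
  k runs once through the triangular numbers, the result is Jacobi's formula for the cube modulo
  2.\<close>

lemma euler_cube:
  assumes d: "0 < d"
  shows "euler d ^ 3 = bit_theta (\<lambda>k::int. int d * (2 * k\<^sup>2 - k)) UNIV"
proof -
  let ?e = "\<lambda>k::int. int d * (2 * k\<^sup>2 - k)"
  let ?o = "qpochX_inf d (2 * d) :: bit fps"
  have "qpochX_inf d (d + 3 * d) * qpochX_inf (3 * d) (d + 3 * d) * euler (d + 3 * d) = bit_theta ?e UNIV"
  proof (rule jacobi_triple_theta)
    fix k :: int
    obtain r where r: "k * (k - 1) = 2 * r" using evenE[of "k * (k - 1)"] by auto
    then have h: "2 * k\<^sup>2 - k = 4 * r + k" by (simp add: algebra_simps power2_eq_square)
    show "?e k = int (d + 3 * d) * (k * (k - 1) div 2) + int d * k"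
      unfolding h r by (simp add: algebra_simps)
    have "0 \<le> k * (k - 1)" "0 \<le> k * (k + 1)"
      by (cases "k > 0"; cases "k < 0"; auto intro: mult_nonpos_nonpos)+
    then have "\<bar>k\<bar> \<le> 4 * r + k"
      using r by (simp add: algebra_simps)
    also have "\<dots> \<le> int d * (4 * r + k)"
      using d calculation mult_right_mono[of 1 "int d" "4 * r + k"] by fastforce
    finally show "\<bar>k\<bar> \<le> ?e k" unfolding h .
  qed (use d in auto)
  then have "?o * euler (4 * d) = bit_theta ?e UNIV"
    using qpochX_inf_split_odd[OF d, where 'a = bit] by simp
  moreover have "euler (4 * d) = (euler d :: bit fps) ^ 4"
    by (rule euler_power4_bit[OF d])
  moreover have "?o * (euler d)\<^sup>2 = euler d"
    using euler_double[OF d, where 'a = bit] euler_square_bit[OF d] by simp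
  moreover have "?o * euler d ^ 4 = (?o * (euler d)\<^sup>2) * (euler d)\<^sup>2"
    by (simp only: power2_eq_square power4_eq_xxxx mult_ac)
  moreover have "euler d * (euler d)\<^sup>2 = (euler d :: bit fps) ^ 3"
    by (simp only: power2_eq_square power3_eq_cube mult_ac)
  ultimately show ?thesis by simp
qed

section \<open>A parity count of lattice points\<close>

lemma even_card_involution:
  assumes "finite S" "\<And>x. x \<in> S \<Longrightarrow> f x \<in> S" "\<And>x. x \<in> S \<Longrightarrow> f (f x) = x" "\<And>x. x \<in> S \<Longrightarrow> f x \<noteq> x"
  shows "even (card S)"
  using assms
proof (induction S rule: finite_psubset_induct)
  case (psubset S)
  show ?case
  proof (cases "S = {}")
    case False
    then obtain x where x: "x \<in> S" by blast
    define T where "T = S - {x, f x}"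
    have "even (card T)"
    proof (rule psubset.IH)
      show "f y \<in> T" if "y \<in> T" for y
      proof -
        have y: "y \<in> S" "y \<noteq> x" "y \<noteq> f x" using that by (auto simp: T_def)
        then show ?thesis
          using psubset.prems(1)[OF y(1)] psubset.prems(2)[OF y(1)] psubset.prems(2)[OF x] by (auto simp: T_def)
      qed
    qed (use x psubset.prems in \<open>auto simp: T_def\<close>)
    moreover have "S = insert x (insert (f x) T)" "x \<notin> insert (f x) T" "f x \<notin> T" "finite T"
      using x psubset.prems[OF x] psubset.hyps by (auto simp: T_def)
    ultimately show ?thesis by (metis card_insert_disjoint even_Suc finite_insert)
  qed simp
qed

lemma even_card_fixed_points:
  assumes "finite S" "\<And>x. x \<in> S \<Longrightarrow> f x \<in> S" "\<And>x. x \<in> S \<Longrightarrow> f (f x) = x"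
  shows "even (card S) \<longleftrightarrow> even (card {x\<in>S. f x = x})"
proof -
  have "even (card {x\<in>S. f x \<noteq> x})"
    by (rule even_card_involution[of _ f]) (use assms in auto)
  moreover have "card S = card {x\<in>S. f x = x} + card {x\<in>S. f x \<noteq> x}"
    using assms(1) by (subst card_Un_disjoint[symmetric]) (auto intro: arg_cong[where f = card])
  ultimately show ?thesis by simp
qed

lemma even_card_sym_diff:
  assumes "finite A" "finite B"
  shows "even (card ((A - B) \<union> (B - A))) \<longleftrightarrow> (even (card A) \<longleftrightarrow> even (card B))"
proof -
  have "card A = card (A \<inter> B) + card (A - B)" "card B = card (A \<inter> B) + card (B - A)"
    using assms by (simp_all add: card_Int_Diff[of A B] card_Int_Diff[of B A] Int_commute)
  moreover have "card ((A - B) \<union> (B - A)) = card (A - B) + card (B - A)"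
    using assms by (intro card_Un_disjoint) auto
  ultimately show ?thesis by auto
qed

lemma abs_le_pronic: "\<bar>x\<bar> - 1 \<le> x * (x + 1)" for x :: int
proof -
  have "0 \<le> (x + 1) * (x + 1)" "0 \<le> x * x" by simp_all
  moreover have "x \<le> x * x" by (cases "x > 0") (auto intro: order_trans[of _ 0])
  ultimately show ?thesis by (simp add: algebra_simps abs_le_iff abs_if)
qed

text \<open>A term of the Appell-Lerch sum times the theta series of \<open>euler 6 ^ 3\<close> whose exponent is 2
  modulo 4 has exponent \<open>4 * hform n l k + 2\<close>, where \<open>n\<close> is the Appell-Lerch index and
  \<open>2 * (2 * l - k) + 1\<close> the index of the geometric series (see \<open>triple_reparametrize\<close>).\<close>
definition hform :: "int \<Rightarrow> int \<Rightarrow> int \<Rightarrow> int" where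
  "hform n l k = 3 * (n * (n + 1)) + 6 * (n * l) + 3 * (k * k) - 2 * k + l"

definition box :: "int \<Rightarrow> (int \<times> int \<times> int) set" where
  "box b = {-b..b} \<times> {-b..b} \<times> {-b..b}"

lemma finite_boxI:
  fixes S :: "(int \<times> int \<times> int) set"
  assumes "\<And>n l k. (n, l, k) \<in> S \<Longrightarrow> \<bar>n\<bar> \<le> b \<and> \<bar>l\<bar> \<le> b \<and> \<bar>k\<bar> \<le> b"
  shows "finite S"
proof (rule finite_subset)
  show "S \<subseteq> box b" using assms by (force simp: box_def abs_le_iff)
qed (simp add: box_def)

text \<open>For fixed n and s = l + k, only the pronic number of n - k varies. This shows the
  reflection in k, and a lower bound whenever n s is nonnegative.\<close>

lemma hform_eq_pronic_diff: "hform n l k = 3 * ((n - k) * (n - k + 1)) + 6 * ((l + k) * n) + (l + k)"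
  by (simp add: hform_def algebra_simps)

text \<open>The form adapted to regions where l and s = l + k have opposite signs: there -6 s l is
  nonnegative and absorbs the growth of l.\<close>

lemma hform_eq_pronic_sum: "hform n l k = 3 * ((n + l) * (n + l + 1)) - 6 * ((l + k) * l) + 3 * ((l + k) * (l + k - 1)) + (l + k)"
  by (simp add: hform_def algebra_simps)

text \<open>The form in terms of n, k and m = 2l - k; doubling clears the denominator of l = (m +
  k)/2. Apart from terms in n m and linear terms it is a sum of squares.\<close>

lemma two_hform_eq:
  "2 * hform n l k = 3 * (n * n + (n + k) * (n + k) + k * k - k + 2 * n) + 6 * (n * (2 * l - k)) + (2 * l - k)"
  by (simp add: hform_def algebra_simps)

text \<open>Since the form is indefinite, finiteness depends on the region. Here the cross term 6 n
  (l + k) is nonnegative and the pronic term controls |n - k|, so the value bounds all three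
  coordinates. The bound 4|c| + 8 is a generous linear one that serves for every region
  below.\<close>

lemma finite_hform_n_nonneg: "finite {(n, l, k). 0 \<le> n \<and> 0 < l + k \<and> hform n l k = c}"
proof (rule finite_boxI[of _ "4 * \<bar>c\<bar> + 8"], clarify)
  fix n l k assume a: "0 \<le> n" "0 < l + k" and c: "c = hform n l k"
  have "n \<le> (l + k) * n" using a mult_right_mono[of 1 "l + k" n] by simp
  then show "\<bar>n\<bar> \<le> 4 * \<bar>hform n l k\<bar> + 8 \<and> \<bar>l\<bar> \<le> 4 * \<bar>hform n l k\<bar> + 8 \<and> \<bar>k\<bar> \<le> 4 * \<bar>hform n l k\<bar> + 8"
    using abs_le_pronic[of "n - k"] a hform_eq_pronic_diff[of n l k] by linarith
qed

lemma finite_hform_n_neg: "finite {(n, l, k). n < 0 \<and> l + k < 0 \<and> hform n l k = c}"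
proof (rule finite_boxI[of _ "4 * \<bar>c\<bar> + 8"], clarify)
  fix n l k assume a: "n < 0" "l + k < 0" and c: "c = hform n l k"
  have "- n \<le> (l + k) * n" "- (l + k) \<le> (l + k) * n"
    using a mult_right_mono_neg[of "l + k" "-1" n] mult_left_mono_neg[of n "-1" "l + k"] by simp_all
  then show "\<bar>n\<bar> \<le> 4 * \<bar>hform n l k\<bar> + 8 \<and> \<bar>l\<bar> \<le> 4 * \<bar>hform n l k\<bar> + 8 \<and> \<bar>k\<bar> \<le> 4 * \<bar>hform n l k\<bar> + 8"
    using abs_le_pronic[of "n - k"] a hform_eq_pronic_diff[of n l k] by linarith
qed

lemma finite_hform_l_neg: "finite {(n, l, k). l < 0 \<and> 0 < l + k \<and> hform n l k = c}"
proof (rule finite_boxI[of _ "4 * \<bar>c\<bar> + 8"], clarify)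
  fix n l k assume a: "l < 0" "0 < l + k" and c: "c = hform n l k"
  have "l \<ge> (l + k) * l" using a mult_right_mono_neg[of 1 "l + k" l] by simp
  moreover have "0 \<le> (l + k) * (l + k - 1)" using a by simp
  ultimately show "\<bar>n\<bar> \<le> 4 * \<bar>hform n l k\<bar> + 8 \<and> \<bar>l\<bar> \<le> 4 * \<bar>hform n l k\<bar> + 8 \<and> \<bar>k\<bar> \<le> 4 * \<bar>hform n l k\<bar> + 8"
    using abs_le_pronic[of "n + l"] a hform_eq_pronic_sum[of n l k] by linarith
qed

lemma finite_hform_l_nonneg: "finite {(n, l, k). 0 \<le> l \<and> l + k < 0 \<and> hform n l k = c}"
proof (rule finite_boxI[of _ "4 * \<bar>c\<bar> + 8"], clarify)
  fix n l k assume a: "0 \<le> l" "l + k < 0" and c: "c = hform n l k"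
  have "- l \<ge> (l + k) * l" using a mult_right_mono[of "l + k" "-1" l] by simp
  moreover have "- (l + k - 1) \<le> (l + k) * (l + k - 1)"
    using a mult_right_mono_neg[of "l + k" "-1" "l + k - 1"] by simp
  ultimately show "\<bar>n\<bar> \<le> 4 * \<bar>hform n l k\<bar> + 8 \<and> \<bar>l\<bar> \<le> 4 * \<bar>hform n l k\<bar> + 8 \<and> \<bar>k\<bar> \<le> 4 * \<bar>hform n l k\<bar> + 8"
    using abs_le_pronic[of "n + l"] a hform_eq_pronic_sum[of n l k] by linarith
qed

lemma finite_hform_nl: "finite {(n, l, k). (0 \<le> n \<longleftrightarrow> 0 \<le> l) \<and> hform n l k = c}"
proof (rule finite_boxI[of _ "4 * \<bar>c\<bar> + 8"], clarify)
  fix n l k assume a: "0 \<le> n \<longleftrightarrow> 0 \<le> l" and c: "c = hform n l k"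
  have k: "\<bar>k\<bar> \<le> 3 * (k * k) - 2 * k"
    using abs_le_pronic[of "-k"] abs_le_pronic[of "k"] by (cases "k = 0") (auto simp: algebra_simps, linarith?)
  show "\<bar>n\<bar> \<le> 4 * \<bar>hform n l k\<bar> + 8 \<and> \<bar>l\<bar> \<le> 4 * \<bar>hform n l k\<bar> + 8 \<and> \<bar>k\<bar> \<le> 4 * \<bar>hform n l k\<bar> + 8"
  proof (cases "0 \<le> n")
    case True
    then have l: "0 \<le> l" using a by simp
    then have "0 \<le> n * l" using True by simp
    moreover define P Q R where "P = n * (n + 1)" and "Q = n * l" and "R = 3 * (k * k) - 2 * k"
    moreover have "hform n l k = 3 * P + 6 * Q + R + l" by (simp add: hform_def P_def Q_def R_def)
    ultimately show ?thesis using abs_le_pronic[of n, folded P_def] l k[folded R_def] True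
      by (intro conjI; linarith)
  next
    case False
    then have l: "l < 0" and n: "n < 0" using a by simp_all
    then have "- n \<le> n * l" "- l \<le> n * l"
      using mult_right_mono_neg[of n "-1" l] mult_left_mono_neg[of l "-1" n] by simp_all
    moreover define P Q R where "P = n * (n + 1)" and "Q = n * l" and "R = 3 * (k * k) - 2 * k"
    moreover have "hform n l k = 3 * P + 6 * Q + R + l" by (simp add: hform_def P_def Q_def R_def)
    ultimately show ?thesis using abs_le_pronic[of n, folded P_def] l n k[folded R_def]
      by (intro conjI; linarith)
  qed
qed

lemma finite_hform_nm: "finite {(n, l, k). (0 \<le> n \<longleftrightarrow> 0 \<le> 2 * l - k) \<and> hform n l k = c}"
proof (rule finite_boxI[of _ "4 * \<bar>c\<bar> + 8"], clarify)
  fix n l k assume a: "0 \<le> n \<longleftrightarrow> 0 \<le> 2 * l - k" and c: "c = hform n l k"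
  have k: "\<bar>k\<bar> - 1 \<le> k * k - k"
    using abs_le_pronic[of "-k"] by (simp add: algebra_simps)
  have s: "0 \<le> (n + k) * (n + k)" by simp
  show "\<bar>n\<bar> \<le> 4 * \<bar>hform n l k\<bar> + 8 \<and> \<bar>l\<bar> \<le> 4 * \<bar>hform n l k\<bar> + 8 \<and> \<bar>k\<bar> \<le> 4 * \<bar>hform n l k\<bar> + 8"
  proof (cases "0 \<le> n")
    case True
    then have m: "0 \<le> 2 * l - k" using a by simp
    define N S K T where "N = n * n + 2 * n" and "S = (n + k) * (n + k)"
      and "K = k * k - k" and "T = n * (2 * l - k)"
    note defs = N_def S_def K_def T_def
    have h: "2 * hform n l k = 3 * N + 3 * S + 3 * K + 6 * T + (2 * l - k)"
      using two_hform_eq[of n l k] by (simp add: defs)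
    have "0 \<le> T" unfolding T_def using m True by (intro mult_nonneg_nonneg)
    moreover have "n - 1 \<le> N" unfolding N_def using True by (simp add: algebra_simps)
    ultimately have "3 * n + 3 * \<bar>k\<bar> + (2 * l - k) \<le> 2 * hform n l k + 6"
      using k[folded K_def] s[folded S_def] h by linarith
    then show ?thesis using m True by (intro conjI; linarith)
  next
    case False
    then have m: "2 * l - k < 0" and n: "n < 0" using a by simp_all
    define N S K T where "N = n * n + 2 * n" and "S = (n + k) * (n + k)"
      and "K = k * k - k" and "T = n * (2 * l - k)"
    note defs = N_def S_def K_def T_def
    have h: "2 * hform n l k = 3 * N + 3 * S + 3 * K + 6 * T + (2 * l - k)"
      using two_hform_eq[of n l k] by (simp add: defs)
    have "- n \<le> T" "- (2 * l - k) \<le> T"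
      unfolding T_def using m n mult_right_mono_neg[of n "-1" "2 * l - k"] mult_left_mono_neg[of "2 * l - k" "-1" n] by simp_all
    moreover have "- 1 \<le> N"
    proof -
      have "0 \<le> (n + 1) * (n + 1)" by simp
      then show ?thesis by (simp add: N_def algebra_simps)
    qed
    ultimately have "3 * \<bar>k\<bar> - n - 8 * l + 4 * k \<le> 2 * hform n l k + 6"
      using k[folded K_def] s[folded S_def] h by linarith
    then show ?thesis using m n by (intro conjI; linarith)
  qed
qed

section \<open>Two reflections of the form and the parity count\<close>

lemma hform_reflect_n: "hform (-1 - 2 * l - n) l k = hform n l k"
  by (simp add: hform_def algebra_simps)

lemma hform_reflect_l: "hform n (2 * (l + k) - 1 - 2 * n - l) (1 + 2 * n - k) = hform n l k"
  by (simp add: hform_def algebra_simps)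

text \<open>For fixed l and k the form depends on n through 3n(n + 1 + 2l), which is symmetric under
  n -> -1 - 2l - n. A fixed point would make 2n odd. Any condition on l and k alone is
  preserved.\<close>

lemma even_reflect_n:
  assumes "finite {(n, l, k). Q l k \<and> hform n l k = c}" (is "finite ?S")
  shows "even (card {(n, l, k). Q l k \<and> hform n l k = c})"
proof (rule even_card_involution[OF assms])
  let ?f = "\<lambda>(n, l, k). (-1 - 2 * l - n, l, k)"
  fix x assume "x \<in> ?S"
  then obtain n l k where x: "x = (n, l, k)" "Q l k" "hform n l k = c" by auto
  then show "?f x \<in> ?S" "?f (?f x) = x" by (simp_all add: hform_reflect_n)
  have "-1 - 2 * l - n \<noteq> n" by presburger
  then show "?f x \<noteq> x" using x by simp
qed

text \<open>For fixed n and l + k, the pronic number of n - k is symmetric under k -> 2n + 1 - k,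
  and l moves so that l + k stays. A fixed point would make 2k odd. Any condition on n and l + k is
  preserved.\<close>

lemma even_reflect_l:
  assumes "finite {(n, l, k). Q n (l + k) \<and> hform n l k = c}" (is "finite ?S")
  shows "even (card {(n, l, k). Q n (l + k) \<and> hform n l k = c})"
proof (rule even_card_involution[OF assms])
  let ?f = "\<lambda>(n, l, k). (n, 2 * (l + k) - 1 - 2 * n - l, 1 + 2 * n - k)"
  fix x assume "x \<in> ?S"
  then obtain n l k where x: "x = (n, l, k)" "Q n (l + k)" "hform n l k = c" by auto
  have "2 * (l + k) - 1 - 2 * n - l + (1 + 2 * n - k) = l + k" by simp
  then show "?f x \<in> ?S" using x by (simp only: prod.case mem_Collect_eq hform_reflect_l)
  show "?f (?f x) = x" using x by simp
  have "1 + 2 * n - k \<noteq> k" by presburger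
  then show "?f x \<noteq> x" using x by simp
qed

text \<open>The two sets differ exactly where 2l - k and l have different sign status. This
  condition does not mention n, so the reflection in n pairs off the whole symmetric
  difference.\<close>

lemma parity_hform_nm_nl:
  "even (card {(n, l, k). (0 \<le> n \<longleftrightarrow> 0 \<le> 2 * l - k) \<and> hform n l k = c}) \<longleftrightarrow>
   even (card {(n, l, k). (0 \<le> n \<longleftrightarrow> 0 \<le> l) \<and> hform n l k = c})" (is "even (card ?B) \<longleftrightarrow> even (card ?C)")
proof -
  have eq: "(?B - ?C) \<union> (?C - ?B) = {(n, l, k). (0 \<le> 2 * l - k \<longleftrightarrow> l < 0) \<and> hform n l k = c}"
    by (auto simp: not_le)
  have "even (card ((?B - ?C) \<union> (?C - ?B)))"
    unfolding eq
  proof (rule even_reflect_n)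
    show "finite {(n, l, k). (0 \<le> 2 * l - k \<longleftrightarrow> l < 0) \<and> hform n l k = c}"
      unfolding eq[symmetric] using finite_hform_nm finite_hform_nl by blast
  qed
  then show ?thesis using even_card_sym_diff[OF finite_hform_nm finite_hform_nl] by simp
qed

text \<open>On l + k > 0 the sign condition says that exactly one of 0 \<le> n and l < 0 holds. The
  half-space for n is stable under the reflection fixing n and l + k, the one for l under the
  reflection fixing l and k. For l + k < 0 the complementary half-spaces are taken below, since
  those are the ones with finite fibres.\<close>

lemma even_hform_sum_pos: "even (card {(n, l, k). (0 \<le> n \<longleftrightarrow> 0 \<le> l) \<and> 0 < l + k \<and> hform n l k = c})"
proof -
  let ?P = "{(n, l, k). (0 \<le> n \<and> 0 < l + k) \<and> hform n l k = c}"
  let ?Q = "{(n, l, k). (l < 0 \<and> 0 < l + k) \<and> hform n l k = c}"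
  have fin: "finite ?P" "finite ?Q" using finite_hform_n_nonneg[of c] finite_hform_l_neg[of c] by (simp_all add: conj_assoc)
  have "even (card ?P)"
    using even_reflect_l[of "\<lambda>n s. 0 \<le> n \<and> 0 < s" c] fin by simp
  moreover have "even (card ?Q)"
    using even_reflect_n[of "\<lambda>l k. l < 0 \<and> 0 < l + k" c] fin by simp
  moreover have "{(n, l, k). (0 \<le> n \<longleftrightarrow> 0 \<le> l) \<and> 0 < l + k \<and> hform n l k = c} = (?P - ?Q) \<union> (?Q - ?P)"
    by auto
  ultimately show ?thesis using even_card_sym_diff[OF fin] by simp
qed

lemma even_hform_sum_neg: "even (card {(n, l, k). (0 \<le> n \<longleftrightarrow> 0 \<le> l) \<and> l + k < 0 \<and> hform n l k = c})"
proof -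
  let ?P = "{(n, l, k). (n < 0 \<and> l + k < 0) \<and> hform n l k = c}"
  let ?Q = "{(n, l, k). (0 \<le> l \<and> l + k < 0) \<and> hform n l k = c}"
  have fin: "finite ?P" "finite ?Q" using finite_hform_n_neg[of c] finite_hform_l_nonneg[of c] by (simp_all add: conj_assoc)
  have "even (card ?P)"
    using even_reflect_l[of "\<lambda>n s. n < 0 \<and> s < 0" c] fin by simp
  moreover have "even (card ?Q)"
    using even_reflect_n[of "\<lambda>l k. 0 \<le> l \<and> l + k < 0" c] fin by simp
  moreover have "{(n, l, k). (0 \<le> n \<longleftrightarrow> 0 \<le> l) \<and> l + k < 0 \<and> hform n l k = c} = (?P - ?Q) \<union> (?Q - ?P)"
    by auto
  ultimately show ?thesis using even_card_sym_diff[OF fin] by simp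
qed

text \<open>On the plane k = -l the form is symmetric in n and l, so the parity is that of the
  diagonal n = l = -i, where the value is 6(2i^2 - i).\<close>

lemma parity_hform_sum_zero:
  "even (card {(n, l, k). (0 \<le> n \<longleftrightarrow> 0 \<le> l) \<and> l + k = 0 \<and> hform n l k = c}) \<longleftrightarrow>
   even (card {i::int. 6 * (2 * i\<^sup>2 - i) = c})" (is "even (card ?S) \<longleftrightarrow> even (card ?T)")
proof -
  let ?f = "\<lambda>(n, l, k). (l, n, -n) :: int \<times> int \<times> int"
  have fin: "finite ?S"
    by (rule finite_subset[OF _ finite_hform_nl[of c]]) auto
  have sw: "hform l n (-n) = hform n l (-l)" for n l
    by (simp add: hform_eq_pronic_sum add.commute)
  have "even (card ?S) \<longleftrightarrow> even (card {x\<in>?S. ?f x = x})"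
  proof (rule even_card_fixed_points[OF fin])
    fix x assume "x \<in> ?S"
    then obtain n l where x: "x = (n, l, -l)" "0 \<le> n \<longleftrightarrow> 0 \<le> l" "hform n l (-l) = c"
      by (auto simp: add_eq_0_iff)
    show "?f x \<in> ?S" "?f (?f x) = x" using x sw[of l n] by auto
  qed
  also have "{x\<in>?S. ?f x = x} = (\<lambda>i. (-i, -i, i)) ` ?T"
  proof -
    have "hform (-i) (-i) i = 6 * (2 * i\<^sup>2 - i)" for i
      by (simp add: hform_def algebra_simps power2_eq_square)
    note h = this
    show ?thesis
    proof (intro equalityI subsetI)
      fix x assume "x \<in> {x\<in>?S. ?f x = x}"
      moreover obtain n l k where x: "x = (n, l, k)" by (cases x)
      ultimately have "l + k = 0" "hform n l k = c" "(l, n, -n) = (n, l, k)"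
        by (simp_all only: mem_Collect_eq prod.case)
      moreover from this(3) have "l = n" "- n = k" by blast+
      ultimately have "hform n l k = c" "n = - k" "l = - k" by (blast, linarith+)
      then have "x = (-k, -k, k)" "6 * (2 * k\<^sup>2 - k) = c" using h[of k] x by simp_all
      then show "x \<in> (\<lambda>i. (-i, -i, i)) ` ?T" by (intro image_eqI[of _ _ k]) simp_all
    next
      fix x assume "x \<in> (\<lambda>i. (-i, -i, i)) ` ?T"
      then obtain k where "x = (-k, -k, k)" "hform (-k) (-k) k = c" using h by auto
      then show "x \<in> {x\<in>?S. ?f x = x}" by simp
    qed
  qed
  also have "card ((\<lambda>i. (-i, -i, i)) ` ?T) = card ?T"
    by (rule card_image) (auto simp: inj_on_def)
  finally show ?thesis .
qed

lemma parity_hform: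
  "even (card {(n, l, k). (0 \<le> n \<longleftrightarrow> 0 \<le> 2 * l - k) \<and> hform n l k = c}) \<longleftrightarrow>
   even (card {i::int. 6 * (2 * i\<^sup>2 - i) = c})"
proof -
  let ?C = "\<lambda>P. {(n, l, k). (0 \<le> n \<longleftrightarrow> 0 \<le> l) \<and> P (l + k) \<and> hform n l k = c}"
  have fin: "finite (?C P)" for P
    by (rule finite_subset[OF _ finite_hform_nl[of c]]) auto
  have "{(n, l, k). (0 \<le> n \<longleftrightarrow> 0 \<le> l) \<and> hform n l k = c} = ?C (\<lambda>s. 0 < s) \<union> ?C (\<lambda>s. s < 0) \<union> ?C (\<lambda>s. s = 0)"
    by auto
  moreover have "card (?C (\<lambda>s. 0 < s) \<union> ?C (\<lambda>s. s < 0) \<union> ?C (\<lambda>s. s = 0)) =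
      card (?C (\<lambda>s. 0 < s) \<union> ?C (\<lambda>s. s < 0)) + card (?C (\<lambda>s. s = 0))"
    using fin by (intro card_Un_disjoint finite_UnI) auto
  moreover have "card (?C (\<lambda>s. 0 < s) \<union> ?C (\<lambda>s. s < 0)) = card (?C (\<lambda>s. 0 < s)) + card (?C (\<lambda>s. s < 0))"
    using fin by (intro card_Un_disjoint) auto
  ultimately have "even (card {(n, l, k). (0 \<le> n \<longleftrightarrow> 0 \<le> l) \<and> hform n l k = c}) \<longleftrightarrow> even (card (?C (\<lambda>s. s = 0)))"
    using even_hform_sum_pos[of c] even_hform_sum_neg[of c] by (simp only: even_add simp_thms)
  then show ?thesis by (simp only: parity_hform_sum_zero parity_hform_nm_nl)
qed

text \<open>The exponent is even only for odd a = 2m + 1. A shift of i by about n/2, with a sign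
  depending on the parity of n, introduces k; the exponent is then 2 modulo 4 exactly when m + k is
  even, and l is half of m + k.\<close>

lemma triple_reparametrize:
  "card {((n, a), i). (0 \<le> n \<longleftrightarrow> 0 \<le> a) \<and> 9 * (n * (n + 1)) + 1 + a * (6 * n + 1) + 6 * (2 * i\<^sup>2 - i) = 4 * c + (2::int)} =
   card {(n, l, k). (0 \<le> n \<longleftrightarrow> 0 \<le> 2 * l - k) \<and> hform n l k = c}" (is "card ?A = card ?B")
proof -
  define f :: "int \<times> int \<times> int \<Rightarrow> (int \<times> int) \<times> int" where
    "f = (\<lambda>(n, l, k). ((n, 2 * (2 * l - k) + 1), if even n then k + n div 2 else - k - n div 2))"
  define g :: "(int \<times> int) \<times> int \<Rightarrow> int \<times> int \<times> int" where
    "g = (\<lambda>((n, a), i). let k = (if even n then i - n div 2 else - i - n div 2) in (n, (a div 2 + k) div 2, k))"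
  \<comment> \<open>For both parities of n, (4i - 1)^2 = (4k + 2n - 1)^2. As 8(2i^2 - i) + 1 = (4i -
    1)^2, the case distinction disappears and one quadratic polynomial in n, m, k remains.\<close>
  have key: "9 * (n * (n + 1)) + 1 + (2 * m + 1) * (6 * n + 1) + 6 * (2 * i\<^sup>2 - i) =
      2 * (6 * (n * (n + 1)) + 6 * (n * (k + m)) + 6 * (k * k) - 3 * k + m) + 2"
    if "i = (if even n then k + n div 2 else - k - n div 2)" for n m i k :: int
  proof (cases "even n")
    case True
    then obtain v where n: "n = 2 * v" by (elim evenE)
    then have i: "i = k + v" using that by simp
    show ?thesis unfolding i n by (simp add: algebra_simps power2_eq_square)
  next
    case False
    then obtain v where n: "n = 2 * v + 1" by (elim oddE)
    then have i: "i = - k - v" using that by simp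
    show ?thesis unfolding i n by (simp add: algebra_simps power2_eq_square)
  qed
  have h: "6 * (n * (n + 1)) + 6 * (n * (k + (2 * l - k))) + 6 * (k * k) - 3 * k + (2 * l - k) = 2 * hform n l k" for n l k
    by (simp add: hform_def algebra_simps)
  have "bij_betw f ?B ?A"
  proof (rule bij_betw_byWitness[of _ g])
    show "\<forall>x\<in>?B. g (f x) = x"
      by (auto simp: f_def g_def Let_def)
    have *: "odd a \<and> even (a div 2 + k) \<and>
        hform n ((a div 2 + k) div 2) k = c \<and> 2 * ((a div 2 + k) div 2) - k = a div 2 \<and>
        i = (if even n then k + n div 2 else - k - n div 2)"
      if e: "9 * (n * (n + 1)) + 1 + a * (6 * n + 1) + 6 * (2 * i\<^sup>2 - i) = 4 * c + 2"
      and k: "k = (if even n then i - n div 2 else - i - n div 2)" for n a i k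
    proof -
      have "1 + a * (6 * n + 1) = 4 * c + 2 - 9 * (n * (n + 1)) - 6 * (2 * i\<^sup>2 - i)"
        using e by linarith
      then have "even (1 + a * (6 * n + 1))"
        by (simp only:) simp
      then have "odd a" by simp
      then obtain m where m: "a = 2 * m + 1" by (elim oddE)
      have i: "i = (if even n then k + n div 2 else - k - n div 2)" using k by simp
      define E where "E = 6 * (n * (n + 1)) + 6 * (n * (k + m)) + 6 * (k * k) - 3 * k + m"
      have "2 * E + 2 = 4 * c + 2"
        using key[OF i, of m, folded E_def] e unfolding m by (simp only:)
      then have E: "E = 2 * c" by simp
      \<comment> \<open>E is congruent to m + k modulo 2, so E = 2c makes m + k even and hence l
        integral.\<close>
      moreover have "E = 2 * (3 * (n * (n + 1)) + 3 * (n * (k + m)) + 3 * (k * k) - 2 * k) + (m + k)"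
        by (simp add: E_def)
      ultimately have mk: "even (m + k)" by presburger
      then obtain l where l: "m + k = 2 * l" by (elim evenE)
      then have ml: "m = 2 * l - k" by simp
      have "hform n l k = c" using E unfolding E_def ml h by simp
      then show ?thesis using i m l by simp
    qed
    show "\<forall>y\<in>?A. f (g y) = y"
    proof clarify
      fix n a i assume e: "9 * (n * (n + 1)) + 1 + a * (6 * n + 1) + 6 * (2 * i\<^sup>2 - i) = 4 * c + 2"
      define k where "k = (if even n then i - n div 2 else - i - n div 2)"
      have "g ((n, a), i) = (n, (a div 2 + k) div 2, k)" by (simp add: g_def k_def Let_def)
      moreover have "f (n, l, k) = ((n, a), i)" if "l = (a div 2 + k) div 2" for l
      proof -
        have "2 * l - k = a div 2" "i = (if even n then k + n div 2 else - k - n div 2)" "odd a"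
          using *[OF e k_def] that by blast+
        moreover from this have "2 * (a div 2) + 1 = a" by presburger
        ultimately show ?thesis by (simp only: f_def prod.case)
      qed
      ultimately show "f (g ((n, a), i)) = ((n, a), i)" by simp
    qed
    show "f ` ?B \<subseteq> ?A"
    proof (rule image_subsetI)
      fix x assume "x \<in> ?B"
      moreover obtain n l k where x: "x = (n, l, k)" by (cases x)
      ultimately have B: "0 \<le> n \<longleftrightarrow> 0 \<le> 2 * l - k" and c: "hform n l k = c" by simp_all
      have "9 * (n * (n + 1)) + 1 + (2 * (2 * l - k) + 1) * (6 * n + 1) +
         6 * (2 * (if even n then k + n div 2 else - k - n div 2)\<^sup>2 - (if even n then k + n div 2 else - k - n div 2)) =
         4 * c + 2"
        unfolding key[OF refl] h c by simp
      moreover have "0 \<le> 2 * (2 * l - k) + 1 \<longleftrightarrow> 0 \<le> 2 * l - k" by presburger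
      ultimately show "f x \<in> ?A"
        using B unfolding x f_def by (simp only: prod.case mem_Collect_eq)
    qed
    show "g ` ?A \<subseteq> ?B"
    proof (rule image_subsetI)
      fix x assume "x \<in> ?A"
      moreover obtain n a i where x: "x = ((n, a), i)" by (metis surj_pair)
      ultimately have A: "0 \<le> n \<longleftrightarrow> 0 \<le> a"
        and e: "9 * (n * (n + 1)) + 1 + a * (6 * n + 1) + 6 * (2 * i\<^sup>2 - i) = 4 * c + 2" by simp_all
      define k where "k = (if even n then i - n div 2 else - i - n div 2)"
      have g: "g x = (n, (a div 2 + k) div 2, k)" by (simp add: g_def k_def Let_def x)
      have "0 \<le> a div 2 \<longleftrightarrow> 0 \<le> a" by presburger
      then show "g x \<in> ?B" unfolding g using *[OF e k_def] A by (simp only: prod.case mem_Collect_eq)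
    qed
  qed
  then show ?thesis by (rule bij_betw_same_card[symmetric])
qed

section \<open>The Appell-Lerch form modulo 2\<close>

lemma of_nat_bit_eq_iff: "(of_nat m :: bit) = of_nat n \<longleftrightarrow> (even m \<longleftrightarrow> even n)"
proof -
  have "(of_nat m :: bit) = (if even m then 0 else 1)" for m by (induction m) (auto simp: add_bit_eq_xor)
  then show ?thesis by simp
qed

lemma of_int_bit_eq_0_iff: "(of_int s :: bit) = 0 \<longleftrightarrow> even s"
proof (cases "even s")
  case True
  then obtain t where "s = 2 * t" by (elim evenE)
  then show ?thesis by simp
next
  case False
  then obtain t where "s = 2 * t + 1" by (elim oddE)
  then show ?thesis by simp
qed

lemma fps_sum_nth_nat:
  assumes "\<And>k::nat. m \<le> k \<Longrightarrow> fps_nth (c k) m = 0"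
  shows "finite {k \<in> UNIV. fps_nth (c k) m \<noteq> 0}" "fps_nth (fps_sum c UNIV) m = (\<Sum>k<m. fps_nth (c k) m)"
proof -
  have lt: "k < m" if "fps_nth (c k) m \<noteq> 0" for k
    using assms[of k] that by linarith
  then have "{k \<in> UNIV. fps_nth (c k) m \<noteq> 0} \<subseteq> {..<m}" by blast
  then show "finite {k \<in> UNIV. fps_nth (c k) m \<noteq> 0}" by (rule finite_subset) simp
  show "fps_nth (fps_sum c UNIV) m = (\<Sum>k<m. fps_nth (c k) m)"
    by (rule fps_sum_nth_eq) (use lt in auto)
qed

section \<open>Reduction of the series modulo 2\<close>

definition fps_mod2 :: "int fps \<Rightarrow> bit fps" where
  "fps_mod2 f = Abs_fps (\<lambda>n. of_int (fps_nth f n))"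

lemma fps_mod2_nth: "fps_nth (fps_mod2 f) n = of_int (fps_nth f n)"
  by (simp add: fps_mod2_def)

lemma fps_mod2_mult: "fps_mod2 (f * g) = fps_mod2 f * fps_mod2 g"
  by (simp add: fps_eq_iff fps_mod2_nth fps_mult_nth)

lemma fps_mod2_diff: "fps_mod2 (f - g) = fps_mod2 f - fps_mod2 g"
  by (rule fps_ext) (simp only: fps_mod2_nth fps_sub_nth of_int_diff)

lemma fps_mod2_one: "fps_mod2 1 = 1"
  by (simp add: fps_eq_iff fps_mod2_nth)

lemma fps_mod2_X_power: "fps_mod2 (fps_X ^ k) = fps_X ^ k"
  by (simp add: fps_eq_iff fps_mod2_nth fps_X_power_nth)

lemma fps_mod2_X: "fps_mod2 fps_X = fps_X"
  using fps_mod2_X_power[of 1] by simp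

lemma fps_mod2_qpochX: "fps_mod2 (qpochX a d n) = qpochX a d n"
proof -
  have "fps_mod2 (\<Prod>i<n. 1 - fps_X ^ (a + d * i)) = (\<Prod>i<n. 1 - fps_X ^ (a + d * i))"
    by (induction n) (simp_all only: prod.lessThan_Suc lessThan_0 prod.empty fps_mod2_mult fps_mod2_diff fps_mod2_one fps_mod2_X_power)
  then show ?thesis by (simp only: qpochX_eq_prod)
qed

lemma fps_mod2_xi_term:
  "fps_mod2 (xi_term (Suc n)) =
     fps_X * (fps_X ^ (6 * (n * (n + 1))) * inverse (qpochX 1 6 (Suc n) * qpochX 5 6 (Suc n)))"
proof -
  have d: "xi_denom (Suc n) = qpochX 1 6 (Suc n) * qpochX 5 6 (Suc n)"
    by (simp add: xi_denom_def)
  have "(qpochX 1 6 (Suc n) * qpochX 5 6 (Suc n)) * fps_mod2 (fps_right_inverse (xi_denom (Suc n)) 1) = 1"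
    using arg_cong[OF xi_denom_recip[of "Suc n"], of fps_mod2]
    by (simp only: fps_mod2_mult fps_mod2_one d fps_mod2_qpochX)
  then have "inverse (qpochX 1 6 (Suc n) * qpochX 5 6 (Suc n)) = fps_mod2 (fps_right_inverse (xi_denom (Suc n)) 1)"
    by (rule fps_inverse_unique)
  moreover have "6 * (Suc n)\<^sup>2 - 6 * Suc n + 1 = Suc (6 * (n * (n + 1)))"
    by (simp add: power2_eq_square algebra_simps)
  ultimately show ?thesis
    unfolding xi_term_def by (simp only: fps_mod2_mult fps_mod2_X_power fps_mod2_X power_Suc mult.assoc)
qed

definition xi_sum :: "int fps" where
  "xi_sum = (\<Sum>n. xi_term (Suc n))"

lemma xi_sum_nth: "fps_nth xi_sum m = (\<Sum>i<m. fps_nth (xi_term (Suc i)) m)"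
proof -
  have "(\<lambda>N. \<Sum>i<N. xi_term (Suc i)) \<longlonglongrightarrow> xi_sum"
    using summable_sums[OF summable_xi_term] unfolding sums_def xi_sum_def .
  then have "\<forall>\<^sub>F N in sequentially. fps_nth (\<Sum>i<N. xi_term (Suc i)) m = fps_nth xi_sum m"
    unfolding tendsto_fps_iff by blast
  then have "\<forall>\<^sub>F N in sequentially. fps_nth (\<Sum>i<N. xi_term (Suc i)) m = fps_nth xi_sum m \<and> m \<le> N"
    using eventually_ge_at_top[of m] by (rule eventually_conj)
  then obtain N where N: "fps_nth (\<Sum>i<N. xi_term (Suc i)) m = fps_nth xi_sum m" "m \<le> N"
    using eventually_happens by force
  have "(\<Sum>i<N. fps_nth (xi_term (Suc i)) m) = (\<Sum>i<m. fps_nth (xi_term (Suc i)) m)"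
    by (rule sum.mono_neutral_right) (use N in \<open>auto intro!: xi_term_nth_eq_0\<close>)
  then show ?thesis using N by (simp add: fps_sum_nth)
qed

lemma fps_mod2_xi_sum: "fps_mod2 xi_sum = fps_sum (\<lambda>n. fps_mod2 (xi_term (Suc n))) UNIV"
proof (rule fps_ext)
  fix m
  have "fps_nth (fps_sum (\<lambda>n. fps_mod2 (xi_term (Suc n))) UNIV) m = (\<Sum>n<m. fps_nth (fps_mod2 (xi_term (Suc n))) m)"
    by (rule fps_sum_nth_nat) (simp add: fps_mod2_nth xi_term_nth_eq_0)
  then show "fps_nth (fps_mod2 xi_sum) m = fps_nth (fps_sum (\<lambda>n. fps_mod2 (xi_term (Suc n))) UNIV) m"
    by (simp add: fps_mod2_nth xi_sum_nth)
qed

lemma inverse_one_minus_X_power: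
  assumes "0 < p"
  shows "inverse (1 - fps_X ^ p :: 'a::field fps) = Abs_fps (\<lambda>i. of_bool (p dvd i))"
proof (rule fps_inverse_unique, rule fps_ext)
  fix i
  let ?g = "Abs_fps (\<lambda>i. of_bool (p dvd i)) :: 'a fps"
  have "fps_nth ((1 - fps_X ^ p) * ?g) i = fps_nth (?g - fps_X ^ p * ?g) i"
    by (simp only: left_diff_distrib mult_1_left)
  also have "\<dots> = of_bool (p dvd i) - (if i < p then 0 else of_bool (p dvd i - p))"
    by (simp add: fps_X_power_mult_nth)
  also have "\<dots> = fps_nth 1 i"
    using assms by (auto simp: dvd_minus_self dest: dvd_imp_le)
  finally show "fps_nth ((1 - fps_X ^ p) * ?g) i = fps_nth 1 i" .
qed

abbreviation same_sign :: "(int \<times> int) set" where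
  "same_sign \<equiv> {(n, a). 0 \<le> n \<longleftrightarrow> 0 \<le> a}"

text \<open>The exponent of term a in the geometric expansion of q^(9n(n+1)+1) / (1 - q^(6n+1)). For
  negative n the expansion in positive powers of q runs over negative a, whence
  \<open>same_sign\<close>.\<close>

definition xi_exponent :: "int \<times> int \<Rightarrow> int" where
  "xi_exponent = (\<lambda>(n, a). 9 * (n * (n + 1)) + 1 + a * (6 * n + 1))"

lemma card_progression:
  fixes b p m :: nat
  assumes "0 < p"
  shows "card {a::nat. b + p * a = m} = of_bool (b \<le> m \<and> p dvd (m - b))"
proof (cases "b \<le> m \<and> p dvd (m - b)")
  case True
  then obtain t where "m = b + p * t" by (metis dvdE le_add_diff_inverse)
  then have "{a::nat. b + p * a = m} = {t}" using assms by auto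
  then show ?thesis using True by simp
next
  case False
  then have "{a::nat. b + p * a = m} = {}" by auto
  then show ?thesis using False by auto
qed

text \<open>Pairs with negative entries encode the expansion of the factor \<open>1 / (1 - X\<^sup>6\<^sup>k\<^sup>+\<^sup>5)\<close>, via
  \<open>n = -1 - k\<close>.\<close>
lemma theta_xi_exponent:
  defines "r \<equiv> \<lambda>k::nat. fps_X * (fps_X ^ (3 * 6 * ((k + 1) * k div 2)) * (1 - fps_X ^ (6 * (2 * k + 1))) *
       inverse ((1 - fps_X ^ (1 + 6 * k)) * (1 - fps_X ^ (5 + 6 * k)))) :: bit fps"
  shows "fps_sum r UNIV = bit_theta xi_exponent same_sign"
    and "finite {k \<in> UNIV. fps_nth (r k) m \<noteq> 0}"
proof -
  define b where "b k = 9 * (k * (k + 1)) + 1" for k :: nat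
  have r: "r k = fps_X ^ b k * (inverse (1 - fps_X ^ (1 + 6 * k)) + fps_X ^ (5 + 6 * k) * inverse (1 - fps_X ^ (5 + 6 * k)))" for k
  proof -
    let ?x = "fps_X ^ (1 + 6 * k) :: bit fps" and ?y = "fps_X ^ (5 + 6 * k) :: bit fps"
    have i: "inverse (1 - ?x) * (1 - ?x) = 1" "(1 - ?y) * inverse (1 - ?y) = 1"
      by (rule inverse_mult_eq_1, simp) (rule inverse_mult_eq_1', simp)
    have "(1 + 6 * k) + (5 + 6 * k) = 6 * (2 * k + 1)" by simp
    then have xy: "?x * ?y = fps_X ^ (6 * (2 * k + 1))" by (simp only: power_add[symmetric])
    \<comment> \<open>From 1 - x y = (1 - y) + y (1 - x): the k-th summand splits into two geometric
      series, one with ratio x and one with ratio y.\<close>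
    have ring: "(1 - x * y) * (A * B) = ((1 - y) * B) * A + y * B * (A * (1 - x))" for x y A B :: "bit fps"
      by (simp add: algebra_simps del: bit_fps_minus bit_fps_add_self bit_fps_2)
    have "(1 - ?x * ?y) * inverse ((1 - ?x) * (1 - ?y)) =
        ((1 - ?y) * inverse (1 - ?y)) * inverse (1 - ?x) + ?y * inverse (1 - ?y) * (inverse (1 - ?x) * (1 - ?x))"
      unfolding fps_inverse_mult by (rule ring)
    also have "\<dots> = inverse (1 - ?x) + ?y * inverse (1 - ?y)"
      unfolding i by (simp only: mult_1_left mult_1_right)
    finally have "(1 - ?x * ?y) * inverse ((1 - ?x) * (1 - ?y)) = inverse (1 - ?x) + ?y * inverse (1 - ?y)" .
    moreover have "Suc (3 * 6 * ((k + 1) * k div 2)) = b k"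
    proof -
      obtain t where "(k + 1) * k = 2 * t" using evenE[of "(k + 1) * k"] by auto
      then show ?thesis by (simp add: b_def mult.commute)
    qed
    then have "fps_X * fps_X ^ (3 * 6 * ((k + 1) * k div 2)) = (fps_X ^ b k :: bit fps)"
      by (simp only: power_Suc[symmetric])
    ultimately show ?thesis unfolding r_def xy by (simp only: mult.assoc[symmetric]) (simp only: mult.assoc)
  qed
  define U where "U k m = {a::nat. b k + (1 + 6 * k) * a = m}" for k m
  define V where "V k m = {a::nat. b k + (5 + 6 * k) + (5 + 6 * k) * a = m}" for k m
  have rn: "fps_nth (r k) m = of_nat (card (U k m) + card (V k m))" for k m
  proof -
    have pos: "0 < 1 + 6 * k" "0 < 5 + 6 * k" by simp_all
    have "fps_nth (r k) m = (if m < b k then 0 else of_bool (1 + 6 * k dvd m - b k)) +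
        (if m < b k + (5 + 6 * k) then 0 else of_bool (5 + 6 * k dvd m - (b k + (5 + 6 * k))))"
      unfolding r distrib_left mult.assoc[symmetric] power_add[symmetric] fps_add_nth fps_X_power_mult_nth
        inverse_one_minus_X_power[OF pos(1)] inverse_one_minus_X_power[OF pos(2)]
      by (simp only: fps_nth_Abs_fps)
    also have "\<dots> = of_nat (card (U k m)) + of_nat (card (V k m))"
      unfolding U_def V_def by (subst (1 2) card_progression) (auto simp: not_le)
    finally show ?thesis by simp
  qed
  have bk: "k < b k" for k by (simp add: b_def)
  have UV: "U k m = {}" "V k m = {}" if "m \<le> k" for k m
    using that bk[of k] by (auto simp: U_def V_def)
  show fin: "finite {k \<in> UNIV. fps_nth (r k) m \<noteq> 0}" for m
    by (rule fps_sum_nth_nat) (simp add: rn UV)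
  show "fps_sum r UNIV = bit_theta xi_exponent same_sign"
  proof (rule fps_ext)
    fix m
    let ?T = "{x \<in> same_sign. xi_exponent x = int m}"
    let ?u = "\<lambda>k. (\<lambda>a. (int k, int a)) ` U k m" and ?v = "\<lambda>k. (\<lambda>a. (- 1 - int k, - 1 - int a)) ` V k m"
    have e1: "xi_exponent (int k, int a) = int (b k + (1 + 6 * k) * a)" for k a
      by (simp add: xi_exponent_def b_def algebra_simps)
    \<comment> \<open>Under n = -1 - k the product n(n+1) is that of k, and (-1 - a)(6n + 1) = (a +
      1)(6k + 5); the shift by one accounts for the extra factor y in the second geometric
      series.\<close>
    have e2: "xi_exponent (- 1 - int k, - 1 - int a) = int (b k + (5 + 6 * k) + (5 + 6 * k) * a)" for k a
      by (simp add: xi_exponent_def b_def algebra_simps)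
    have T: "?T = (\<Union>k\<in>{..<m}. ?u k \<union> ?v k)"
    proof (intro equalityI subsetI)
      fix x assume "x \<in> ?T"
      moreover obtain n a where x: "x = (n, a)" by (cases x)
      ultimately have h: "0 \<le> n \<longleftrightarrow> 0 \<le> a" "xi_exponent (n, a) = int m" by auto
      show "x \<in> (\<Union>k\<in>{..<m}. ?u k \<union> ?v k)"
      proof (cases "0 \<le> n")
        case True
        define k j where "k = nat n" and "j = nat a"
        have na: "n = int k" "a = int j" using True h by (auto simp: k_def j_def)
        then have "j \<in> U k m" using h(2) unfolding na e1 U_def by (simp only: of_nat_eq_iff mem_Collect_eq)
        moreover from this have "k < m" using UV[of m k] by force
        ultimately show ?thesis using x na by blast
      next
        case False
        define k j where "k = nat (- 1 - n)" and "j = nat (- 1 - a)"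
        have na: "n = - 1 - int k" "a = - 1 - int j" using False h by (auto simp: k_def j_def)
        then have "j \<in> V k m" using h(2) unfolding na e2 V_def by (simp only: of_nat_eq_iff mem_Collect_eq)
        moreover from this have "k < m" using UV[of m k] by force
        ultimately show ?thesis using x na by blast
      qed
    next
      fix x assume "x \<in> (\<Union>k\<in>{..<m}. ?u k \<union> ?v k)"
      then consider k a where "x = (int k, int a)" "a \<in> U k m" | k a where "x = (- 1 - int k, - 1 - int a)" "a \<in> V k m"
        by blast
      then show "x \<in> ?T"
      proof cases
        case 1
        then have "xi_exponent x = int m" using e1[of k a] unfolding U_def by simp
        then show ?thesis using 1 by simp
      next
        case 2
        then have "xi_exponent x = int m" using e2[of k a] unfolding V_def by simp
        then show ?thesis using 2 by simp
      qed
    qed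
    have finUV: "finite (U k m)" "finite (V k m)" for k
      by (rule finite_subset[of _ "{..m}"]; auto simp: U_def V_def algebra_simps)+
    have "card ?T = (\<Sum>k<m. card (?u k \<union> ?v k))"
      unfolding T using finUV by (intro card_UN_disjoint) auto
    also have "\<dots> = (\<Sum>k<m. card (U k m) + card (V k m))"
    proof (rule sum.cong)
      fix k
      have "card (?u k \<union> ?v k) = card (?u k) + card (?v k)"
        using finUV by (intro card_Un_disjoint) auto
      also have "card (?u k) = card (U k m)" by (rule card_image) (auto simp: inj_on_def)
      also have "card (?v k) = card (V k m)" by (rule card_image) (auto simp: inj_on_def)
      finally show "card (?u k \<union> ?v k) = card (U k m) + card (V k m)" .
    qed simp
    finally have cT: "card ?T = (\<Sum>k<m. card (U k m) + card (V k m))" .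
    have "fps_nth (fps_sum r UNIV) m = (\<Sum>k<m. fps_nth (r k) m)"
      by (rule fps_sum_nth_nat) (simp add: rn UV)
    then show "fps_nth (fps_sum r UNIV) m = fps_nth (bit_theta xi_exponent same_sign) m"
      unfolding bit_theta_def fps_nth_Abs_fps cT by (simp add: rn)
  qed
qed

text \<open>The truncated Bailey identity is multiplied by E_6^2. On the right each of the two
  inverse finite products absorbs one factor E_6 and tends to 1; on the left there is only one such
  product, so one E_6 survives in the limit.\<close>

lemma euler_times_xi_sum: "euler 6 * fps_mod2 xi_sum = bit_theta xi_exponent same_sign"
proof -
  define P where "P n = inverse (qpochX 6 6 n :: bit fps)" for n
  let ?E = "euler 6 :: bit fps"
  define c where "c n = fps_X * (fps_X ^ (6 * (n * (n + 1))) * inverse (qpochX 1 6 (Suc n) * qpochX 5 6 (Suc n) :: bit fps))" for n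
  define r where "r k = fps_X * (fps_X ^ (3 * 6 * ((k + 1) * k div 2)) * (1 - fps_X ^ (6 * (2 * k + 1))) *
       inverse ((1 - fps_X ^ (1 + 6 * k)) * (1 - fps_X ^ (5 + 6 * k))) :: bit fps)" for k :: nat
  have minus: "filterlim (\<lambda>N. N - k) sequentially sequentially" for k :: nat
    unfolding filterlim_at_top eventually_sequentially
  proof
    fix Z :: nat
    show "\<exists>M. \<forall>N\<ge>M. Z \<le> N - k" by (rule exI[of _ "Z + k"]) auto
  qed
  have plus: "filterlim (\<lambda>N. N + k) sequentially sequentially" for k :: nat
    unfolding filterlim_at_top eventually_sequentially
  proof
    fix Z :: nat
    show "\<exists>M. \<forall>N\<ge>M. Z \<le> N + k" by (rule exI[of _ Z]) auto
  qed
  have u: "(\<lambda>N. ?E * P (N - k)) \<longlonglongrightarrow> 1" "(\<lambda>N. ?E * P (N + k + 1)) \<longlonglongrightarrow> 1" for k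
    unfolding P_def using minus plus[of "k + 1"] by (intro euler_inverse_tendsto; simp)+
  have ev: "\<forall>\<^sub>F N in sequentially. k \<in> {..N}" for k :: nat
    using eventually_ge_at_top[of k] by simp
  have "(\<lambda>N. \<Sum>n\<le>N. c n * (?E * P (N - n))) \<longlonglongrightarrow> fps_sum c UNIV"
  proof (rule fps_sum_tendsto)
    fix m
    have "fps_nth (c n) m = 0" if "m \<le> n" for n
      using xi_term_nth_eq_0[OF that] fps_mod2_nth[of "xi_term (Suc n)" m] unfolding fps_mod2_xi_term c_def by simp
    then show "finite {k \<in> UNIV. fps_nth (c k) m \<noteq> 0}"
      by (rule fps_sum_nth_nat)
  qed (use ev u in auto)
  then have "(\<lambda>N. ?E * (\<Sum>n\<le>N. c n * (?E * P (N - n)))) \<longlonglongrightarrow> ?E * fps_sum c UNIV"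
    by (intro fps_tendsto_mult tendsto_const)
  moreover have "?E * (\<Sum>n\<le>N. c n * (?E * P (N - n))) =
      (\<Sum>k\<le>N. r k * ((?E * P (N - k)) * (?E * P (N + k + 1))))" for N
  proof -
    have b: "(\<Sum>n\<le>N. fps_X ^ (6 * (n * (n + 1))) * inverse (qpochX 1 6 (Suc n) * qpochX 5 6 (Suc n)) * P (N - n)) =
      (\<Sum>k\<le>N. fps_X ^ (3 * 6 * ((k + 1) * k div 2)) * (1 - fps_X ^ (6 * (2 * k + 1))) *
       inverse ((1 - fps_X ^ (1 + 6 * k)) * (1 - fps_X ^ (5 + 6 * k))) * (P (N - k) * P (N + k + 1)))"
      using bailey_transform_X[where 'a = bit, of 1 5 N] by (simp add: P_def)
    have "?E * (\<Sum>n\<le>N. c n * (?E * P (N - n))) = fps_X * ?E * ?E *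
       (\<Sum>n\<le>N. fps_X ^ (6 * (n * (n + 1))) * inverse (qpochX 1 6 (Suc n) * qpochX 5 6 (Suc n)) * P (N - n))"
      unfolding c_def sum_distrib_left by (simp only: mult_ac)
    also have "\<dots> = (\<Sum>k\<le>N. r k * ((?E * P (N - k)) * (?E * P (N + k + 1))))"
      unfolding b r_def sum_distrib_left by (simp only: mult_ac)
    finally show ?thesis .
  qed
  moreover have "(\<lambda>N. \<Sum>k\<le>N. r k * ((?E * P (N - k)) * (?E * P (N + k + 1)))) \<longlonglongrightarrow> fps_sum r UNIV"
  proof (rule fps_sum_tendsto)
    fix m
    show "finite {k \<in> UNIV. fps_nth (r k) m \<noteq> 0}"
      unfolding r_def by (rule theta_xi_exponent(2))
  next
    fix k
    show "(\<lambda>N. (?E * P (N - k)) * (?E * P (N + k + 1))) \<longlonglongrightarrow> 1"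
      using fps_tendsto_mult[OF u(1)[of k] u(2)[of k]] by simp
  qed (use ev in auto)
  ultimately have "?E * fps_sum c UNIV = fps_sum r UNIV"
    by (simp only: LIMSEQ_unique)
  also have "fps_sum r UNIV = bit_theta xi_exponent same_sign"
    unfolding r_def by (rule theta_xi_exponent(1))
  finally show ?thesis
    unfolding fps_mod2_xi_sum fps_mod2_xi_term c_def .
qed

lemma bit_theta_mult:
  assumes "\<And>x. x \<in> S \<Longrightarrow> 0 \<le> e x" "\<And>y. y \<in> S' \<Longrightarrow> 0 \<le> e' y"
    and "\<And>m. finite {x \<in> S. e x = int m}" "\<And>m. finite {y \<in> S'. e' y = int m}"
  shows "bit_theta e S * bit_theta e' S' = bit_theta (\<lambda>(x, y). e x + e' y) (S \<times> S')"
proof (rule fps_ext)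
  fix m
  let ?A = "\<lambda>i. {x \<in> S. e x = int i}" and ?B = "\<lambda>i. {y \<in> S'. e' y = int i}"
  have U: "{z \<in> S \<times> S'. (case z of (x, y) \<Rightarrow> e x + e' y) = int m} = (\<Union>i\<in>{0..m}. ?A i \<times> ?B (m - i))"
  proof (intro equalityI subsetI)
    fix z assume "z \<in> {z \<in> S \<times> S'. (case z of (x, y) \<Rightarrow> e x + e' y) = int m}"
    then obtain x y where z: "z = (x, y)" "x \<in> S" "y \<in> S'" "e x + e' y = int m" by auto
    have "e x = int (nat (e x))" "nat (e x) \<le> m" "e' y = int (m - nat (e x))"
      using z assms(1)[OF z(2)] assms(2)[OF z(3)] by auto
    then show "z \<in> (\<Union>i\<in>{0..m}. ?A i \<times> ?B (m - i))"
      using z by (intro UN_I[of "nat (e x)"]) simp_all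
  qed auto
  have "fps_nth (bit_theta e S * bit_theta e' S') m = of_nat (\<Sum>i=0..m. card (?A i \<times> ?B (m - i)))"
    by (simp add: fps_mult_nth bit_theta_def card_cartesian_product)
  also have "(\<Sum>i=0..m. card (?A i \<times> ?B (m - i))) = card (\<Union>i\<in>{0..m}. ?A i \<times> ?B (m - i))"
  proof (rule card_UN_disjoint[symmetric])
    show "\<forall>i\<in>{0..m}. finite (?A i \<times> ?B (m - i))"
      using assms(3,4) by (intro ballI finite_cartesian_product)
  qed auto
  also have "of_nat \<dots> = fps_nth (bit_theta (\<lambda>(x, y). e x + e' y) (S \<times> S')) m"
    unfolding bit_theta_def fps_nth_Abs_fps U ..
  finally show "fps_nth (bit_theta e S * bit_theta e' S') m = fps_nth (bit_theta (\<lambda>(x, y). e x + e' y) (S \<times> S')) m" .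
qed

section \<open>Isolating the exponents 2 modulo 4\<close>

lemma bit_theta_nth: "fps_nth (bit_theta e S) m = of_nat (card {x \<in> S. e x = int m})"
  by (simp add: bit_theta_def)

lemma xi_exponent_bound:
  assumes "(n, a) \<in> same_sign"
  shows "\<bar>n\<bar> \<le> xi_exponent (n, a)" "\<bar>a\<bar> \<le> xi_exponent (n, a)"
proof -
  define N T where "N = n * n" and "T = a * n"
  have e: "xi_exponent (n, a) = 9 * N + 9 * n + 1 + 6 * T + a"
    by (simp add: xi_exponent_def N_def T_def algebra_simps)
  have N: "0 \<le> N" by (simp add: N_def)
  have nN: "- n \<le> N"
  proof (cases "n < 0")
    case True
    then show ?thesis using mult_right_mono_neg[of n "-1" n] by (simp add: N_def)
  next
    case False
    then show ?thesis using N by linarith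
  qed
  have "\<bar>n\<bar> \<le> xi_exponent (n, a) \<and> \<bar>a\<bar> \<le> xi_exponent (n, a)"
  proof (cases "0 \<le> n")
    case True
    then have "0 \<le> a" using assms by simp
    moreover from this have "0 \<le> T" unfolding T_def using True by simp
    ultimately show ?thesis unfolding e using N True by (intro conjI; linarith)
  next
    case False
    then have "n < 0" "a < 0" using assms by simp_all
    moreover from this have "- n \<le> T" "- a \<le> T"
      unfolding T_def using mult_right_mono_neg[of a "-1" n] mult_left_mono_neg[of n "-1" a] by simp_all
    ultimately show ?thesis unfolding e using N nN by (intro conjI; linarith)
  qed
  then show "\<bar>n\<bar> \<le> xi_exponent (n, a)" "\<bar>a\<bar> \<le> xi_exponent (n, a)" by simp_all
qed

lemma abs_le_hexagonal: "\<bar>i\<bar> \<le> 2 * i\<^sup>2 - i" for i :: int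
proof -
  have "0 \<le> i * (i - 1)"
    by (cases "i > 0") (auto intro: mult_nonpos_nonpos)
  moreover have "0 \<le> i\<^sup>2" by simp
  ultimately show ?thesis by (simp add: algebra_simps power2_eq_square abs_if)
qed

lemma euler_24_times_xi_sum:
  "euler 24 * fps_mod2 xi_sum =
     bit_theta (\<lambda>(x, i). xi_exponent x + int 6 * (2 * i\<^sup>2 - i)) (same_sign \<times> UNIV)"
proof -
  have "euler 24 * fps_mod2 xi_sum = (euler 6 * fps_mod2 xi_sum) * euler 6 ^ 3"
    using euler_power4_bit[of 6] by (simp add: power4_eq_xxxx power3_eq_cube mult_ac)
  also have "\<dots> = bit_theta xi_exponent same_sign * bit_theta (\<lambda>i. int 6 * (2 * i\<^sup>2 - i)) UNIV"
    unfolding euler_times_xi_sum using euler_cube[of 6] by simp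
  also have "\<dots> = bit_theta (\<lambda>(x, i). xi_exponent x + int 6 * (2 * i\<^sup>2 - i)) (same_sign \<times> UNIV)"
  proof (rule bit_theta_mult)
    fix x assume "x \<in> same_sign"
    then obtain n a where "x = (n, a)" "(n, a) \<in> same_sign" by auto
    then show "0 \<le> xi_exponent x" using xi_exponent_bound(1)[of n a] by simp
  next
    fix i :: int
    show "0 \<le> int 6 * (2 * i\<^sup>2 - i)" using abs_le_hexagonal[of i] by simp
  next
    fix m
    have "{x \<in> same_sign. xi_exponent x = int m} \<subseteq> {-int m..int m} \<times> {-int m..int m}"
    proof
      fix x assume x: "x \<in> {x \<in> same_sign. xi_exponent x = int m}"
      moreover obtain n a where na: "x = (n, a)" by (cases x)
      ultimately have "\<bar>n\<bar> \<le> int m" "\<bar>a\<bar> \<le> int m" using xi_exponent_bound[of n a] by simp_all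
      then show "x \<in> {-int m..int m} \<times> {-int m..int m}" unfolding na by (simp add: abs_le_iff)
    qed
    then show "finite {x \<in> same_sign. xi_exponent x = int m}" by (rule finite_subset) simp
    have "{i \<in> UNIV. int 6 * (2 * i\<^sup>2 - i) = int m} \<subseteq> {-int m..int m}"
    proof
      fix i assume "i \<in> {i \<in> UNIV. int 6 * (2 * i\<^sup>2 - i) = int m}"
      then have "\<bar>i\<bar> \<le> int m" using abs_le_hexagonal[of i] by simp
      then show "i \<in> {-int m..int m}" by (simp add: abs_le_iff)
    qed
    then show "finite {i \<in> UNIV. int 6 * (2 * i\<^sup>2 - i) = int m}" by (rule finite_subset) simp
  qed
  finally show ?thesis .
qed

text \<open>By the lattice count, the coefficient at 4c + 2 is the parity of the solutions of 6(2i^2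
  - i) = c, equivalently 24(2i^2 - i) = 4c. This is the coefficient of E_24^3 at 4c, and E_24^3 =
  E_24 E_48 modulo 2.\<close>

lemma euler_24_times_xi_sum_nth:
  "fps_nth (euler 24 * fps_mod2 xi_sum) (4 * c + 2) = fps_nth (euler 24 * (fps_X\<^sup>2 * euler 48)) (4 * c + 2)"
proof -
  let ?A = "{((n, a), i). (0 \<le> n \<longleftrightarrow> 0 \<le> a) \<and> 9 * (n * (n + 1)) + 1 + a * (6 * n + 1) + 6 * (2 * i\<^sup>2 - i) = 4 * int c + (2::int)}"
  have sq: "(euler 24)\<^sup>2 = (euler 48 :: bit fps)"
    using euler_square_bit[of 24] by simp
  have "{z \<in> same_sign \<times> (UNIV :: int set). (case z of (x, i) \<Rightarrow> xi_exponent x + int 6 * (2 * i\<^sup>2 - i)) = int (4 * c + 2)} = ?A"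
    by (auto simp: xi_exponent_def)
  then have "fps_nth (euler 24 * fps_mod2 xi_sum) (4 * c + 2) = of_nat (card ?A)"
    unfolding euler_24_times_xi_sum bit_theta_def by simp
  also have "\<dots> = of_nat (card {i::int. 6 * (2 * i\<^sup>2 - i) = int c})"
    unfolding of_nat_bit_eq_iff triple_reparametrize by (rule parity_hform)
  also have "{i::int. 6 * (2 * i\<^sup>2 - i) = int c} = {i \<in> UNIV. int 24 * (2 * i\<^sup>2 - i) = int (4 * c)}"
    by auto
  also have "of_nat (card \<dots>) = (fps_nth (euler 24 ^ 3) (4 * c) :: bit)"
    by (subst euler_cube, simp) (simp only: bit_theta_nth)
  also have "\<dots> = fps_nth (fps_X\<^sup>2 * euler 24 ^ 3) (4 * c + 2)"
    by (simp add: fps_X_power_mult_nth)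
  also have "fps_X\<^sup>2 * euler 24 ^ 3 = euler 24 * (fps_X\<^sup>2 * (euler 48 :: bit fps))"
    unfolding sq[symmetric] by (simp only: power2_eq_square power3_eq_cube mult_ac)
  finally show ?thesis .
qed

lemma euler_nth_eq_0:
  assumes "\<not> 4 dvd m"
  shows "fps_nth (euler 24 :: bit fps) m = 0"
proof -
  have "24 * (k * (3 * k - 1) div 2) \<noteq> int m" for k :: int
  proof
    assume "24 * (k * (3 * k - 1) div 2) = int m"
    then have "int m = 4 * (6 * (k * (3 * k - 1) div 2))" by simp
    then have "int 4 dvd int m" by simp
    then show False using assms by (simp only: int_dvd_int_iff)
  qed
  then show ?thesis using euler_pentagonal[of 24] by (simp add: bit_theta_def)
qed

text \<open>E_24 has only exponents divisible by 4, so in the product with D the coefficients at 4c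
  + 2 involve D only in the class 2 modulo 4. With constant term 1, strong induction on c makes all
  of these vanish.\<close>

lemma bit_xi_sum_nth:
  "fps_nth (fps_mod2 xi_sum) (4 * c + 2) = fps_nth (euler 48) (4 * c)"
proof -
  define D where "D = fps_mod2 xi_sum - fps_X\<^sup>2 * euler 48"
  have ED: "fps_nth (euler 24 * D) (4 * c + 2) = 0" for c
    unfolding D_def right_diff_distrib fps_sub_nth euler_24_times_xi_sum_nth by simp
  have "fps_nth D (4 * c + 2) = 0"
  proof (induction c rule: less_induct)
    case (less c)
    have "fps_nth (euler 24 * D) (4 * c + 2) = (\<Sum>i=0..4 * c + 2. fps_nth (euler 24) i * fps_nth D (4 * c + 2 - i))"
      by (rule fps_mult_nth)
    also have "\<dots> = (\<Sum>i\<in>{0}. fps_nth (euler 24) i * fps_nth D (4 * c + 2 - i))"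
    proof (rule sum.mono_neutral_right)
      show "\<forall>i\<in>{0..4 * c + 2} - {0}. fps_nth (euler 24) i * fps_nth D (4 * c + 2 - i) = 0"
      proof
        fix i assume i: "i \<in> {0..4 * c + 2} - {0}"
        show "fps_nth (euler 24) i * fps_nth D (4 * c + 2 - i) = 0"
        proof (cases "4 dvd i")
          case True
          then obtain j where j: "i = 4 * j" by (elim dvdE)
          then have "4 * c + 2 - i = 4 * (c - j) + 2" "c - j < c" using i by auto
          then show ?thesis using less by simp
        qed (simp add: euler_nth_eq_0)
      qed
    qed auto
    also have "\<dots> = fps_nth D (4 * c + 2)" by (simp add: qpochX_inf_nth_0)
    finally show ?case using ED by simp
  qed
  then have "fps_nth (fps_mod2 xi_sum) (4 * c + 2) = fps_nth (fps_X\<^sup>2 * euler 48) (4 * c + 2)"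
    unfolding D_def fps_sub_nth by (simp only: right_minus_eq)
  then show ?thesis by (simp add: fps_X_power_mult_nth)
qed

lemma odd_xi_sum_iff: "odd (fps_nth xi_sum (4 * n + 2)) \<longleftrightarrow> (\<exists>k::int. int n = 6 * k * (3 * k - 1))"
proof -
  let ?K = "{k \<in> UNIV. int 48 * (k * (3 * k - 1) div 2) = int (4 * n)}"
  have K: "?K = {k. int n = 6 * k * (3 * k - 1)}"
  proof -
    have "int 48 * (k * (3 * k - 1) div 2) = int (4 * n) \<longleftrightarrow> int n = 6 * k * (3 * k - 1)" for k :: int
    proof -
      have "even (k * (3 * k - 1))" by simp
      then have "2 * (k * (3 * k - 1) div 2) = k * (3 * k - 1)" by simp
      moreover have "int 48 * h = 4 * (6 * (2 * h))" for h by simp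
      ultimately have "int 48 * (k * (3 * k - 1) div 2) = 4 * (6 * (k * (3 * k - 1)))" by metis
      moreover have "4 * x = int (4 * n) \<longleftrightarrow> int n = x" for x by auto
      ultimately show ?thesis by (simp only: mult.assoc)
    qed
    then show ?thesis by simp
  qed
  \<comment> \<open>Uniqueness of k makes the number of representations 0 or 1, so its parity
    detects existence. The second factor 3(k + j) - 1 is nonzero because it is -1 modulo 3.\<close>
  have inj: "k = j" if "6 * k * (3 * k - 1) = 6 * j * (3 * j - 1)" for k j :: int
  proof -
    have "6 * ((k - j) * (3 * (k + j) - 1)) = 6 * k * (3 * k - 1) - 6 * j * (3 * j - 1)"
      by (simp add: algebra_simps)
    then have "(k - j) * (3 * (k + j) - 1) = 0" using that by simp
    moreover have "3 * (k + j) - 1 \<noteq> 0" by presburger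
    ultimately show ?thesis by simp
  qed
  have "(of_int (fps_nth xi_sum (4 * n + 2)) :: bit) = of_nat (card ?K)"
    using bit_xi_sum_nth[of n] unfolding fps_mod2_nth
    by (simp only: euler_pentagonal[of 48, simplified zero_less_numeral simp_thms] bit_theta_nth)
  then have "(of_int (fps_nth xi_sum (4 * n + 2)) :: bit) = 0 \<longleftrightarrow> even (card ?K)"
    using of_nat_bit_eq_iff[of "card ?K" 0] by simp
  then have odd: "odd (fps_nth xi_sum (4 * n + 2)) \<longleftrightarrow> odd (card ?K)"
    unfolding of_int_bit_eq_0_iff by simp
  show ?thesis
  proof (cases "\<exists>k::int. int n = 6 * k * (3 * k - 1)")
    case True
    then obtain k where k: "int n = 6 * k * (3 * k - 1)" by blast
    have "j = k \<longleftrightarrow> int n = 6 * j * (3 * j - 1)" for j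
      using k inj[of j k] by metis
    then have "{k. int n = 6 * k * (3 * k - 1)} = {k}" by blast
    then show ?thesis using True odd unfolding K by simp
  next
    case False
    then have "{k. int n = 6 * k * (3 * k - 1)} = {}" by blast
    then show ?thesis using False odd unfolding K by simp
  qed
qed

theorem theorem4p5:
  fixes n :: nat
  shows "(\<forall>k::int. int n = 6 * k * (3 * k - 1) \<longrightarrow>
            [p_xi (4 * n + 2) = 2 * (-1) ^ nat \<bar>k\<bar>] (mod 4)) \<and>
         ((\<nexists>k::int. int n = 6 * k * (3 * k - 1)) \<longrightarrow>
            [p_xi (4 * n + 2) = 0] (mod 4))"
proof -
  define s where "s = fps_nth xi_sum (4 * n + 2)"
  have p: "p_xi (4 * n + 2) = 2 * s"
    unfolding p_xi_def xi_def xi_sum_def[symmetric] s_def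
    by (simp add: numeral_fps_const)
  show ?thesis
  proof (intro conjI impI allI)
    fix k :: int assume "int n = 6 * k * (3 * k - 1)"
    then have "odd s" unfolding s_def odd_xi_sum_iff by blast
    moreover have "odd ((-1 :: int) ^ nat \<bar>k\<bar>)" by simp
    \<comment> \<open>Both \<open>s\<close> and the sign are odd, so their difference is even and
      doubling it gives a multiple of 4, whichever sign occurs.\<close>
    ultimately have "2 dvd s - (-1) ^ nat \<bar>k\<bar>" by simp
    then have "2 * 2 dvd 2 * (s - (-1) ^ nat \<bar>k\<bar>)" by (rule mult_dvd_mono[OF dvd_refl])
    then show "[p_xi (4 * n + 2) = 2 * (-1) ^ nat \<bar>k\<bar>] (mod 4)"
      unfolding p cong_iff_dvd_diff by (simp add: right_diff_distrib)
  next
    assume "\<nexists>k::int. int n = 6 * k * (3 * k - 1)"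
    then have "even s" unfolding s_def using odd_xi_sum_iff by blast
    then show "[p_xi (4 * n + 2) = 0] (mod 4)"
      unfolding p cong_0_iff by (elim evenE) simp
  qed
qed

end
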